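(* Let $\mathscr{G}$ be a separable Banach-Lie group. Suppose $d$ is a left-invariant metric on $\mathscr{G}$ (i.e. $d(gh,gk)=d(h,k)$ for all $g,h,k\in\mathscr{G}$) and $x=(x^s_t)_{0\le s\le t<\infty}$ is a multiplicative process in $\mathscr{G}$ with càdlàg paths and bounded jumps (with respect to an additive filtration satisfying the usual hypotheses on a complete probability space). Write $x_t=x^0_t$. Then for all $0<r<u$ and all $\alpha\in\mathbb{R}$, $$\mathbb{E}\Bigl(\sup_{r\le s\le t\le u}\mathrm{e}^{\alpha d(x_s,x_t)}\Bigr)<\infty .$$ Moreover, for fixed $T>0$, $$\lim_{|u-r|\to0}\mathbb{E}\Bigl(\sup_{r\le s\le t\le u}\mathrm{e}^{\alpha d(x_s,x_t)}-1\Bigr)=0,\qquad\text{where } r<u<T .$$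
   Context: A Banach-Lie group $\mathscr{G}$ is a group with identity $e$ that is also a Banach manifold (smooth in the Fréchet sense), with smooth multiplication and inversion; its Lie algebra is the Banach space $\mathfrak{g}=T_e\mathscr{G}$ with norm $\|\cdot\|$. The exponential map $\exp:\mathfrak{g}\to\mathscr{G}$ restricts to a diffeomorphism from an open neighbourhood $U_{\mathfrak{g}}$ of $0$ onto an open neighbourhood $U_{\mathscr{G}}$ of $e$ (both fixed); its inverse there is $\log$, with $\operatorname{dom}(\log)=U_{\mathscr{G}}$. Write $B_\delta=\{G\in\mathfrak{g}:\|G\|<\delta\}$, $U_\delta=\exp(B_\delta)$ and $(U_\delta)^n=\{g_1\cdots g_n:g_i\in U_\delta\}$. An additive filtration is a family of $\sigma$-algebras $\mathscr{F}^s_t\subseteq\mathscr{F}$, $0\le s\le t<\infty$, on the underlying complete probability space $(\Omega,\mathscr{F},\mathbb{P})$ such that for all $s\le t\le u\le v$: $\mathscr{F}^s_t$ and $\mathscr{F}^u_v$ are independent, and $\mathscr{F}^t_u\subseteq\mathscr{F}^s_v$. Usual hypotheses: for fixed $s$, $(\mathscr{F}^s_t)_{t\ge s}$ is right-continuous in $t$, and every $\mathscr{F}^s_t$ is complete. A two-parameter process $x=(x^s_t)_{0\le s\le t<\infty}$ of random elements of $\mathscr{G}$ (Borel measurable maps $\Omega\to\mathscr{G}$) is a multiplicative process with respect to $(\mathscr{F}^s_t)_{s\le t}$ if: (1) $x^s_t$ is $\mathscr{F}^s_t$-measurable for all $s\le t$; (2) $x^s_s=e$ and $x^s_tx^t_u=x^s_u$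 almost surely for all $s\le t\le u$; (3) $x$ is stochastically continuous, i.e. for all $s\le t$ and every open $U\ni e$, $\lim_{h,k\to0}\mathbb{P}((x^s_t)^{-1}x^{s+h}_{t+k}\in U)=1$ (any signs of $h,k$ with $0\le s+h\le t+k$). Càdlàg paths means càdlàg in both arguments simultaneously: $(s,t)\mapsto x^s_t(\omega)$ is jointly right-continuous on $\{s\le t\}$ and has joint one-sided limits (each argument approached from the left or from the right). Write $x^{t-}_t=\lim_{s\nearrow t}x^s_t=(x_{t-})^{-1}x_t$, with the convention $x^{0-}_0=e$. The process has bounded jumps if there are $\delta>0$ with $U_\delta\subseteq\operatorname{dom}(\log)$ and $n\in\mathbb{N}$ such that $\mathbb{P}(\forall t\ge0:\ x^{t-}_t\in(U_\delta)^n)=1$. The limit as $|u-r|\to0$ is over pairs $(r,u)$: for every $\varepsilon>0$ there is $H>0$ such that the expectation is less than $\varepsilon$ in absolute value whenever $0<r<u<T$ and $u-r<H$. *)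

theory Defs
  imports "HOL-Probability.Probability" "HOL-Algebra.Coset"
begin

section \<open>Smooth maps between open subsets of normed spaces\<close>

text \<open>
  A \<open>k\<close>-linear map is represented by its values on argument lists of length \<open>k\<close>;
  the values on lists of any other length are irrelevant.
\<close>

definition bounded_multilinear ::
    "nat \<Rightarrow> ('a::real_normed_vector list \<Rightarrow> 'b::real_normed_vector) \<Rightarrow> bool" where
  "bounded_multilinear k T \<longleftrightarrow>
     (\<forall>vs i. length vs = k \<longrightarrow> i < k \<longrightarrow> linear (\<lambda>v. T (vs[i := v]))) \<and>
     (\<exists>C. \<forall>vs. length vs = k \<longrightarrow> norm (T vs) \<le> C * prod_list (map norm vs))"

text \<open>
  Infinite Frechet differentiability.  The iterated derivatives live in spaces of different type, so
  they are given as one family \<open>D\<close>, where \<open>D k x\<close> is the \<open>k\<close>-th derivative at \<open>x\<close>.  The last clause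
  says that \<open>D k\<close>, as a map into the space of bounded \<open>k\<close>-linear maps with the operator norm, has at
  \<open>x\<close> the Frechet derivative \<open>w \<mapsto> D (k + 1) x (w, -)\<close>.
\<close>

definition smooth_on ::
    "'a::real_normed_vector set \<Rightarrow> ('a \<Rightarrow> 'b::real_normed_vector) \<Rightarrow> bool" where
  "smooth_on S f \<longleftrightarrow> open S \<and>
     (\<exists>D :: nat \<Rightarrow> 'a \<Rightarrow> 'a list \<Rightarrow> 'b.
        (\<forall>x\<in>S. D 0 x [] = f x) \<and>
        (\<forall>k. \<forall>x\<in>S. bounded_multilinear k (D k x)) \<and>
        (\<forall>k. \<forall>x\<in>S. \<forall>\<epsilon>>0. \<exists>\<delta>>0. \<forall>y\<in>S. norm (y - x) < \<delta> \<longrightarrow>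
           (\<forall>vs. length vs = k \<longrightarrow>
              norm (D k y vs - D k x vs - D (Suc k) x ((y - x) # vs))
                \<le> \<epsilon> * norm (y - x) * prod_list (map norm vs))))"

section \<open>Banach manifolds\<close>

text \<open>
  A chart is an open set together with a map that is only relevant on that set; the manifold is the
  whole type \<open>'m\<close> with its type-class topology, modelled on the Banach space \<open>'a\<close>.
\<close>

type_synonym ('m, 'a) chart = "'m set \<times> ('m \<Rightarrow> 'a)"
type_synonym ('m, 'a) atlas = "('m, 'a) chart set"

definition banach_atlas :: "('m::topological_space, 'a::banach) atlas \<Rightarrow> bool" where
  "banach_atlas A \<longleftrightarrow>
     (\<Union>(U, \<phi>)\<in>A. U) = UNIV \<and>
     (\<forall>(U, \<phi>)\<in>A. open U \<and> open (\<phi> ` U) \<and> homeomorphism U (\<phi> ` U) \<phi> (inv_into U \<phi>)) \<and>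
     (\<forall>(U, \<phi>)\<in>A. \<forall>(V, \<psi>)\<in>A. smooth_on (\<phi> ` (U \<inter> V)) (\<psi> \<circ> inv_into U \<phi>))"

definition model_atlas :: "('a::banach, 'a) atlas" where
  "model_atlas = {(UNIV, id)}"

definition prod_atlas ::
    "('m, 'a) atlas \<Rightarrow> ('n, 'b) atlas \<Rightarrow> ('m \<times> 'n, 'a \<times> 'b) atlas" where
  "prod_atlas A B = {(U \<times> V, map_prod \<phi> \<psi>) |U \<phi> V \<psi>. (U, \<phi>) \<in> A \<and> (V, \<psi>) \<in> B}"

definition smooth_map_on ::
    "('m::topological_space, 'a::banach) atlas \<Rightarrow> 'm set \<Rightarrow>
     ('n::topological_space, 'b::banach) atlas \<Rightarrow> ('m \<Rightarrow> 'n) \<Rightarrow> bool" where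
  "smooth_map_on A S B f \<longleftrightarrow> open S \<and> continuous_on S f \<and>
     (\<forall>(U, \<phi>)\<in>A. \<forall>(V, \<psi>)\<in>B. smooth_on (\<phi> ` (U \<inter> S \<inter> f -` V)) (\<psi> \<circ> f \<circ> inv_into U \<phi>))"

definition diffeomorphism_on ::
    "('m::topological_space, 'a::banach) atlas \<Rightarrow> 'm set \<Rightarrow>
     ('n::topological_space, 'b::banach) atlas \<Rightarrow> 'n set \<Rightarrow> ('m \<Rightarrow> 'n) \<Rightarrow> bool" where
  "diffeomorphism_on A S B T f \<longleftrightarrow>
     bij_betw f S T \<and> smooth_map_on A S B f \<and> smooth_map_on B T A (inv_into S f)"

section \<open>Banach-Lie groups and the exponential map\<close>

locale banach_lie_group = group G
  for G :: "('g::t2_space) monoid" (structure) and A :: "('g, 'a::banach) atlas" +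
  assumes carrier_UNIV: "carrier G = UNIV"
    and atlas: "banach_atlas A"
    and smooth_mult: "smooth_map_on (prod_atlas A A) UNIV A (\<lambda>(g, h). g \<otimes> h)"
    and smooth_inv: "smooth_map_on A UNIV A (\<lambda>g. inv g)"

definition one_parameter_subgroup ::
    "('g::t2_space) monoid \<Rightarrow> ('g, 'a::banach) atlas \<Rightarrow> (real \<Rightarrow> 'g) \<Rightarrow> bool" where
  "one_parameter_subgroup G A \<gamma> \<longleftrightarrow>
     smooth_map_on model_atlas UNIV A \<gamma> \<and> (\<forall>s t. \<gamma> (s + t) = \<gamma> s \<otimes>\<^bsub>G\<^esub> \<gamma> t)"

text \<open>
  The Lie algebra, i.e. the tangent space at the identity, is identified with the model space \<open>'a\<close>
  through a chart \<open>c\<close> around the identity: the velocity at \<open>0\<close> of a curve \<open>\<gamma>\<close> with \<open>\<gamma> 0 = \<one>\<close> is the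
  derivative at \<open>0\<close> of its expression in \<open>c\<close>.  The norm of \<open>'a\<close> is then the norm of the Lie algebra.
  The exponential map is the map \<open>E\<close> for which \<open>t \<mapsto> E (t X)\<close> is, for each \<open>X\<close>, the one-parameter
  subgroup with initial velocity \<open>X\<close>; this determines \<open>E\<close>.
\<close>

definition lie_exponential ::
    "('g::t2_space) monoid \<Rightarrow> ('g, 'a::banach) atlas \<Rightarrow> ('g, 'a) chart \<Rightarrow> ('a \<Rightarrow> 'g) \<Rightarrow> bool" where
  "lie_exponential G A c E \<longleftrightarrow>
     c \<in> A \<and> \<one>\<^bsub>G\<^esub> \<in> fst c \<and>
     (\<forall>X. one_parameter_subgroup G A (\<lambda>t. E (t *\<^sub>R X)) \<and>
          ((\<lambda>t. snd c (E (t *\<^sub>R X))) has_vector_derivative X) (at 0))"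

text \<open>
  The fixed neighbourhoods \<open>V\<close> of \<open>0\<close> and \<open>W\<close> of the identity between which the exponential map is a
  diffeomorphism; \<open>W\<close> is the domain of the logarithm.
\<close>

definition log_domains ::
    "('g::t2_space) monoid \<Rightarrow> ('g, 'a::banach) atlas \<Rightarrow> ('a \<Rightarrow> 'g) \<Rightarrow> 'a set \<Rightarrow> 'g set \<Rightarrow> bool" where
  "log_domains G A E V W \<longleftrightarrow>
     open V \<and> 0 \<in> V \<and> open W \<and> \<one>\<^bsub>G\<^esub> \<in> W \<and> diffeomorphism_on model_atlas V A W E"

section \<open>Multiplicative processes\<close>

definition two_param_domain :: "(real \<times> real) set" where
  "two_param_domain = {(s, t). 0 \<le> s \<and> s \<le> t}"

definition additive_filtration :: "'w measure \<Rightarrow> (real \<Rightarrow> real \<Rightarrow> 'w measure) \<Rightarrow> bool" where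
  "additive_filtration M F \<longleftrightarrow>
     (\<forall>s t. 0 \<le> s \<longrightarrow> s \<le> t \<longrightarrow> subalgebra M (F s t)) \<and>
     (\<forall>s t u v. 0 \<le> s \<longrightarrow> s \<le> t \<longrightarrow> t \<le> u \<longrightarrow> u \<le> v \<longrightarrow>
        prob_space.indep_set M (sets (F s t)) (sets (F u v)) \<and>
        sets (F t u) \<subseteq> sets (F s v))"

definition usual_hypotheses :: "'w measure \<Rightarrow> (real \<Rightarrow> real \<Rightarrow> 'w measure) \<Rightarrow> bool" where
  "usual_hypotheses M F \<longleftrightarrow>
     (\<forall>s t. 0 \<le> s \<longrightarrow> s \<le> t \<longrightarrow>
        sets (F s t) = (\<Inter>u\<in>{t<..}. sets (F s u)) \<and> null_sets M \<subseteq> sets (F s t))"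

definition multiplicative_process ::
    "('g::t2_space) monoid \<Rightarrow> 'w measure \<Rightarrow> (real \<Rightarrow> real \<Rightarrow> 'w measure) \<Rightarrow>
     (real \<Rightarrow> real \<Rightarrow> 'w \<Rightarrow> 'g) \<Rightarrow> bool" where
  "multiplicative_process G M F x \<longleftrightarrow>
     (\<forall>s t. 0 \<le> s \<longrightarrow> s \<le> t \<longrightarrow> x s t \<in> borel_measurable (F s t)) \<and>
     (\<forall>s\<ge>0. AE \<omega> in M. x s s \<omega> = \<one>\<^bsub>G\<^esub>) \<and>
     (\<forall>s t u. 0 \<le> s \<longrightarrow> s \<le> t \<longrightarrow> t \<le> u \<longrightarrow>
        (AE \<omega> in M. x s t \<omega> \<otimes>\<^bsub>G\<^esub> x t u \<omega> = x s u \<omega>)) \<and>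
     (\<forall>s t U. 0 \<le> s \<longrightarrow> s \<le> t \<longrightarrow> open U \<longrightarrow> \<one>\<^bsub>G\<^esub> \<in> U \<longrightarrow>
        ((\<lambda>(h, k). measure M {\<omega> \<in> space M. inv\<^bsub>G\<^esub> (x s t \<omega>) \<otimes>\<^bsub>G\<^esub> x (s + h) (t + k) \<omega> \<in> U})
           \<longlongrightarrow> 1) (at (0, 0) within {(h, k). (s + h, t + k) \<in> two_param_domain}))"

text \<open>
  Limits are taken within the parameter domain, so a quadrant that does not meet the domain near
  \<open>(s, t)\<close> imposes no condition.
\<close>

definition cadlag2 :: "(real \<Rightarrow> real \<Rightarrow> 'g::topological_space) \<Rightarrow> bool" where
  "cadlag2 y \<longleftrightarrow>
     (\<forall>(s, t)\<in>two_param_domain.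
        ((\<lambda>(s', t'). y s' t') \<longlongrightarrow> y s t) (at (s, t) within ({s..} \<times> {t..}) \<inter> two_param_domain) \<and>
        (\<forall>I\<in>{{..<s}, {s<..}}. \<forall>J\<in>{{..<t}, {t<..}}.
           \<exists>l. ((\<lambda>(s', t'). y s' t') \<longlongrightarrow> l) (at (s, t) within (I \<times> J) \<inter> two_param_domain)))"

definition jump_at ::
    "('g::t2_space) monoid \<Rightarrow> (real \<Rightarrow> real \<Rightarrow> 'g) \<Rightarrow> real \<Rightarrow> 'g" where
  "jump_at G y t = (if t = 0 then \<one>\<^bsub>G\<^esub> else Lim (at_left t) (\<lambda>s. y s t))"

primrec set_power :: "'g monoid \<Rightarrow> 'g set \<Rightarrow> nat \<Rightarrow> 'g set" where
  "set_power G S 0 = {\<one>\<^bsub>G\<^esub>}"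
| "set_power G S (Suc n) = S <#>\<^bsub>G\<^esub> set_power G S n"

text \<open>
  On a complete probability space, a property holds almost everywhere iff the set where it holds is
  an event of probability one.
\<close>

definition bounded_jumps ::
    "('g::t2_space) monoid \<Rightarrow> ('a::banach \<Rightarrow> 'g) \<Rightarrow> 'g set \<Rightarrow> 'w measure \<Rightarrow>
     (real \<Rightarrow> real \<Rightarrow> 'w \<Rightarrow> 'g) \<Rightarrow> bool" where
  "bounded_jumps G E W M x \<longleftrightarrow>
     (\<exists>\<delta>>0. E ` ball 0 \<delta> \<subseteq> W \<and>
        (\<exists>n. AE \<omega> in M. \<forall>t\<ge>0. jump_at G (\<lambda>s t. x s t \<omega>) t \<in> set_power G (E ` ball 0 \<delta>) n))"

text \<open>
  The supremum is taken in \<open>[0, \<infinity>]\<close>.  For \<open>r \<le> u\<close> it is at least \<open>1\<close> (take \<open>s = t\<close>), so subtracting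
  \<open>1\<close> from it involves no truncation.
\<close>

definition sup_exp_dist ::
    "('g \<Rightarrow> 'g \<Rightarrow> real) \<Rightarrow> real \<Rightarrow> (real \<Rightarrow> 'g) \<Rightarrow> real \<Rightarrow> real \<Rightarrow> ennreal" where
  "sup_exp_dist d \<alpha> y r u =
     (SUP (s, t)\<in>{(s, t). r \<le> s \<and> s \<le> t \<and> t \<le> u}. ennreal (exp (\<alpha> * d (y s) (y t))))"

end

theory Submission
  imports Defs
begin

text \<open>
  By left invariance, \<open>d (x\<^sub>s) (x\<^sub>t)\<close> is almost surely the distance from the identity to \<open>x\<^sup>s\<^sub>t\<close>, so it
  depends only on the increment over \<open>[s, t]\<close>; and since an exponential \<open>exp X\<close> is a power of an element
  close to the identity, the jumps have \<open>d\<close>-size at most some \<open>C\<close>.  On \<open>[a, b]\<close> let \<open>p\<close> be the probability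
  of an oscillation larger than \<open>K\<close>.  Each time the path moves by more than \<open>K\<close> it overshoots by at most
  roughly \<open>C\<close>, and what follows is independent of the past, so moving farther than \<open>K + n L\<close> from the
  starting point, with \<open>L = K + C + 1\<close>, has probability at most \<open>p\<^bsup>n+1\<^esup>\<close>.  There are no fixed jumps, so for
  each \<open>K\<close> the number \<open>p\<close> is uniformly small for short intervals in \<open>[0, T]\<close>; the geometric tail then
  beats any exponential weight, which gives the limit.  Long intervals are cut into short ones, over
  which the suprema are submultiplicative and independent.
\<close>

section \<open>Preliminaries\<close>

text \<open>The renewal argument asks for a first passage time, but the filtration gives
  independence only at fixed times. Passages are therefore observed on finite deterministic grids,
  and the resulting bounds, which do not depend on the mesh, are carried over to the continuous
  path. A second obstacle is that \<open>x 0 s \<otimes> x s t = x 0 t\<close> holds outside a null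
  set depending on \<open>s\<close> and \<open>t\<close>, while suprema and jumps involve all times
  at once. A common null set comes from rational times and right-continuity. After that the group is
  forgotten, and the locale \<open>metric_indep_increments\<close> sees only distances along a path.
  The bound on jumps is no compactness statement: balls of an infinite-dimensional Lie algebra are
  not relatively compact, so continuity of the exponential map alone would not bound
  \<open>d\<close> on them.\<close>

lemma lebesgue_number_Icc:
  fixes a b :: real
  assumes "\<And>t. a \<le> t \<Longrightarrow> t \<le> b \<Longrightarrow> \<exists>\<delta>>0. Q t \<delta>"
  shows "\<exists>h>0. \<forall>s\<in>{a..b}. \<exists>t\<in>{a..b}. \<exists>\<delta>>0. Q t \<delta> \<and> ball s h \<subseteq> ball t \<delta>"
proof -
  define \<G> where "\<G> = {ball t \<delta> |t \<delta>. t \<in> {a..b} \<and> \<delta> > 0 \<and> Q t \<delta>}"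
  have "{a..b} \<subseteq> \<Union>\<G>"
  proof
    fix t assume "t \<in> {a..b}"
    with assms[of t] obtain \<delta> where "\<delta> > 0" "Q t \<delta>" by auto
    with \<open>t \<in> {a..b}\<close> show "t \<in> \<Union>\<G>"
      unfolding \<G>_def by (intro UnionI[of "ball t \<delta>"]) auto
  qed
  then obtain h where h: "h > 0" "\<And>s. s \<in> {a..b} \<Longrightarrow> \<exists>B\<in>\<G>. ball s h \<subseteq> B"
    by (rule Heine_Borel_lemma[OF compact_Icc]) (auto simp: \<G>_def)
  have "\<exists>t\<in>{a..b}. \<exists>\<delta>>0. Q t \<delta> \<and> ball s h \<subseteq> ball t \<delta>" if "s \<in> {a..b}" for s
    using h(2)[OF that] unfolding \<G>_def by blast
  with h(1) show ?thesis by blast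
qed

lemma ex_rational_sequence_right:
  fixes s b :: real
  assumes "s < b"
  shows "\<exists>q. (\<forall>n. q n \<in> \<rat> \<and> s < q n \<and> q n < b) \<and> q \<longlonglongrightarrow> s"
proof -
  have "\<exists>r\<in>\<rat>. s < r \<and> r < min b (s + inverse (real (Suc n)))" for n
    using assms by (intro Rats_dense_in_real) auto
  then obtain q where q: "\<And>n. q n \<in> \<rat>" "\<And>n. s < q n" "\<And>n. q n < min b (s + inverse (real (Suc n)))"
    by metis
  have "q \<longlonglongrightarrow> s"
  proof (rule tendsto_sandwich)
    show "eventually (\<lambda>n. s \<le> q n) sequentially" using q(2) by (intro always_eventually allI less_imp_le)
    show "eventually (\<lambda>n. q n \<le> s + inverse (real (Suc n))) sequentially"
      using q(3) by (intro always_eventually allI) (simp add: less_imp_le)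
    show "(\<lambda>n. s + inverse (real (Suc n))) \<longlonglongrightarrow> s"
      using tendsto_add[OF tendsto_const LIMSEQ_inverse_real_of_nat, of s] by simp
  qed simp
  moreover have "q n < b" for n using q(3)[of n] by simp
  ultimately show ?thesis using q(1,2) by blast
qed

text \<open>\<open>N\<close> contains every null set, so it absorbs the set where \<open>f\<close>
  and \<open>g\<close> differ. This carries measurability from the increment \<open>x s t\<close>
  over to the distance of \<open>x 0 s\<close> and \<open>x 0 t\<close>, which is determined by it
  only almost surely.\<close>

lemma borel_measurable_AE_cong_complete:
  fixes f g :: "'w \<Rightarrow> 'b::topological_space"
  assumes "complete_measure M" "subalgebra M N" "null_sets M \<subseteq> sets N"
    and f: "f \<in> borel_measurable N" and ae: "AE \<omega> in M. f \<omega> = g \<omega>"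
  shows "g \<in> borel_measurable N"
proof (rule measurableI)
  interpret complete_measure M by fact
  have sp: "space N = space M" using assms(2) by (simp add: subalgebra_def)
  define Z where "Z = {\<omega> \<in> space M. f \<omega> \<noteq> g \<omega>}"
  have Z: "Z \<in> null_sets M" using ae unfolding AE_iff_null_sets Z_def .
  fix B :: "'b set" assume "B \<in> sets borel"
  then have "f -` B \<inter> space N \<in> sets N" by (rule measurable_sets[OF f])
  moreover have "Z \<in> sets N" using Z assms(3) by blast
  \<comment> \<open>On \<open>Z\<close> nothing is known about \<open>g\<close>; completeness makes
    every subset of \<open>Z\<close> null.\<close>
  moreover have "g -` B \<inter> Z \<in> null_sets M" by (rule complete2[OF _ Z]) blast
  then have "g -` B \<inter> Z \<in> sets N" using assms(3) by blast
  moreover have "g -` B \<inter> space N = (f -` B \<inter> space N - Z) \<union> (g -` B \<inter> Z)"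
    unfolding sp Z_def by auto
  ultimately show "g -` B \<inter> space N \<in> sets N"
    by (simp only: sets.Un sets.Diff)
qed simp

text \<open>The tail intersections \<open>D N\<close> increase to the limit inferior of the
  \<open>A n\<close>, which contains almost all of \<open>B\<close>. In the application the
  \<open>A n\<close> come from grids that are not nested, so they need not be monotone in
  \<open>n\<close>.\<close>

lemma (in prob_space) prob_le_of_eventually_mem:
  assumes A: "\<And>n. A n \<in> events" and B: "B \<in> events"
    and le: "\<And>n. prob (A n) \<le> c"
    and ev: "AE \<omega> in M. \<omega> \<in> B \<longrightarrow> eventually (\<lambda>n. \<omega> \<in> A n) sequentially"
  shows "prob B \<le> c"
proof -
  define D where "D N = (\<Inter>n\<in>{N..}. A n)" for N :: nat
  have D: "D N \<in> events" for N
    unfolding D_def using A by (intro sets.countable_INT) auto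
  have "incseq D"
    unfolding D_def incseq_def by (intro allI impI INT_anti_mono) auto
  then have lim: "(\<lambda>N. prob (D N)) \<longlonglongrightarrow> prob (\<Union>N. D N)"
    using D by (intro finite_Lim_measure_incseq) auto
  have "prob (D N) \<le> c" for N
    using finite_measure_mono[of "D N" "A N"] A le[of N] unfolding D_def by force
  then have "prob (\<Union>N. D N) \<le> c"
    by (intro LIMSEQ_le_const2[OF lim]) auto
  moreover have "prob B \<le> prob (\<Union>N. D N)"
  proof (rule finite_measure_mono_AE)
    show "AE \<omega> in M. \<omega> \<in> B \<longrightarrow> \<omega> \<in> (\<Union>N. D N)"
      using ev by eventually_elim (auto simp: D_def eventually_sequentially)
    show "(\<Union>N. D N) \<in> events" using D by auto
  qed
  ultimately show ?thesis by linarith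
qed

text \<open>Each \<open>D N\<close> lies in every later \<open>A n\<close>, so it is null.
  Convergence in probability is used in this form: almost surely \<open>A n\<close> fails infinitely
  often, which is enough once the path is known to have a limit.\<close>

lemma (in prob_space) AE_not_eventually_of_prob_tendsto_0:
  assumes A: "\<And>n. A n \<in> events" and lim: "(\<lambda>n. prob (A n)) \<longlonglongrightarrow> 0"
  shows "AE \<omega> in M. \<not> eventually (\<lambda>n. \<omega> \<in> A n) sequentially"
proof -
  define D where "D N = (\<Inter>n\<in>{N..}. A n)" for N :: nat
  have D: "D N \<in> events" for N
    unfolding D_def using A by (intro sets.countable_INT) auto
  have "prob (D N) \<le> 0" for N
  proof (rule LIMSEQ_le_const[OF lim], intro exI allI impI)
    fix n assume "N \<le> n"
    then show "prob (D N) \<le> prob (A n)"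
      using A by (intro finite_measure_mono) (auto simp: D_def)
  qed
  then have "prob (D N) = 0" for N by (simp add: measure_le_0_iff)
  then have "AE \<omega> in M. \<omega> \<notin> D N" for N using D prob_eq_0 by blast
  then have "AE \<omega> in M. \<forall>N. \<omega> \<notin> D N" by (simp add: AE_all_countable)
  then show ?thesis
  proof eventually_elim
    case (elim \<omega>)
    show ?case
    proof
      assume "eventually (\<lambda>n. \<omega> \<in> A n) sequentially"
      then obtain N where "\<And>n. n \<ge> N \<Longrightarrow> \<omega> \<in> A n" unfolding eventually_sequentially by blast
      then have "\<omega> \<in> D N" unfolding D_def by simp
      with elim show False by simp
    qed
  qed
qed

section \<open>Metric-valued processes with independent increments\<close>

text \<open>\<open>'g\<close> carries no topology here, so limits of paths are distances tending to
  0, and the jump at \<open>t\<close> has size \<open>d l (y t \<omega>)\<close> with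
  \<open>l\<close> the left limit. Independence of increments enters through
  \<open>dist_measurable\<close>, which places the distance over \<open>[s, t]\<close> in
  \<open>F s t\<close>. Regularity is required of every path, the two conditions on jumps only
  almost surely.\<close>

locale metric_indep_increments = prob_space M + dist: Metric_space UNIV d
  for M :: "'w measure" and d :: "'g \<Rightarrow> 'g \<Rightarrow> real" +
  fixes F :: "real \<Rightarrow> real \<Rightarrow> 'w measure" and y :: "real \<Rightarrow> 'w \<Rightarrow> 'g" and C :: real
  assumes filtration: "additive_filtration M F"
    and dist_measurable:
      "\<And>s t. 0 \<le> s \<Longrightarrow> s \<le> t \<Longrightarrow> (\<lambda>\<omega>. d (y s \<omega>) (y t \<omega>)) \<in> borel_measurable (F s t)"
    and right_cont:
      "\<And>\<omega> t. \<omega> \<in> space M \<Longrightarrow> 0 \<le> t \<Longrightarrow> ((\<lambda>s. d (y s \<omega>) (y t \<omega>)) \<longlongrightarrow> 0) (at_right t)"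
    and left_limit:
      "\<And>\<omega> t. \<omega> \<in> space M \<Longrightarrow> 0 < t \<Longrightarrow> \<exists>l. ((\<lambda>s. d (y s \<omega>) l) \<longlongrightarrow> 0) (at_left t)"
    and C_nonneg: "0 \<le> C"
    and jump_le: "AE \<omega> in M. \<forall>t>0. \<forall>l. ((\<lambda>s. d (y s \<omega>) l) \<longlongrightarrow> 0) (at_left t) \<longrightarrow> d l (y t \<omega>) \<le> C"
    and no_fixed_jump: "\<And>t. 0 < t \<Longrightarrow> AE \<omega> in M. ((\<lambda>s. d (y s \<omega>) (y t \<omega>)) \<longlongrightarrow> 0) (at_left t)"
begin

section \<open>Distances along a path and the filtration\<close>

lemma d_self [simp]: "d g g = 0"
  by simp

lemma d_triangle: "d g k \<le> d g h + d h k"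
  by (rule dist.triangle) auto

lemma d_triangle2: "d g k \<le> d h g + d h k"
  by (metis d_triangle dist.commute)

lemma F_subalgebra: "0 \<le> s \<Longrightarrow> s \<le> t \<Longrightarrow> subalgebra M (F s t)"
  using filtration by (simp add: additive_filtration_def)

lemma space_F [simp]: "0 \<le> s \<Longrightarrow> s \<le> t \<Longrightarrow> space (F s t) = space M"
  using F_subalgebra by (simp add: subalgebra_def)

lemma sets_F_subset: "0 \<le> s \<Longrightarrow> s \<le> t \<Longrightarrow> sets (F s t) \<subseteq> events"
  using F_subalgebra by (simp add: subalgebra_def)

lemma sets_F_mono:
  assumes "0 \<le> s" "s \<le> t" "t \<le> u" "u \<le> v"
  shows "sets (F t u) \<subseteq> sets (F s v)"
  using filtration assms unfolding additive_filtration_def by blast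

lemma indep_F: "0 \<le> s \<Longrightarrow> s \<le> t \<Longrightarrow> t \<le> u \<Longrightarrow> indep_set (sets (F s t)) (sets (F t u))"
  using filtration unfolding additive_filtration_def by blast

lemma dist_sets:
  assumes "0 \<le> a" "a \<le> s" "s \<le> t" "t \<le> b" "B \<in> sets borel"
  shows "{\<omega> \<in> space M. d (y s \<omega>) (y t \<omega>) \<in> B} \<in> sets (F a b)"
proof -
  have "(\<lambda>\<omega>. d (y s \<omega>) (y t \<omega>)) -` B \<inter> space (F s t) \<in> sets (F s t)"
    using assms by (intro measurable_sets[OF dist_measurable]) auto
  moreover have "(\<lambda>\<omega>. d (y s \<omega>) (y t \<omega>)) -` B \<inter> space (F s t) = {\<omega> \<in> space M. d (y s \<omega>) (y t \<omega>) \<in> B}"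
    using assms by auto
  ultimately show ?thesis
    using sets_F_mono[of a s t b] assms by auto
qed

lemma dist_tendsto:
  assumes "((\<lambda>s. d (y s \<omega>) l) \<longlongrightarrow> 0) H"
  shows "((\<lambda>s. d (y s \<omega>) z) \<longlongrightarrow> d l z) H"
proof -
  have "\<bar>d (y s \<omega>) z - d l z\<bar> \<le> d (y s \<omega>) l" for s
    using d_triangle[of "y s \<omega>" z l] d_triangle2[of l z "y s \<omega>"] by linarith
  then have "((\<lambda>s. d (y s \<omega>) z - d l z) \<longlongrightarrow> 0) H"
    by (intro Lim_null_comparison[OF _ assms]) auto
  then show ?thesis
    by (simp add: LIM_zero_iff)
qed

lemma dist_tendsto_right:
  assumes "\<omega> \<in> space M" "0 \<le> t"
  shows "((\<lambda>s. d (y s \<omega>) z) \<longlongrightarrow> d (y t \<omega>) z) (at_right t)"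
  by (intro dist_tendsto right_cont assms)

section \<open>Measurability of path events through countably many times\<close>

definition dense_times :: "real \<Rightarrow> real \<Rightarrow> real set" where
  "dense_times a b = insert b (\<rat> \<inter> {a..b})"

lemma countable_dense_times: "countable (dense_times a b)"
  unfolding dense_times_def by (intro countable_insert countable_Int1 countable_rat)

text \<open>Right-continuity allows every time to be moved slightly to the right, to a rational one.
  At \<open>b\<close> there is no room for this, which is why \<open>dense_times\<close> contains
  \<open>b\<close> itself.\<close>

lemma dense_times_approx:
  fixes a b t :: real
  assumes "a \<le> t" "t \<le> b" "P t" "eventually P (at_right t)"
  obtains q where "q \<in> dense_times a b" "t \<le> q" "q \<le> b" "P q"
proof (cases "t < b")
  case False
  with assms that[of b] show thesis by (auto simp: dense_times_def)
next
  case True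
  from assms(4) obtain c where c: "c > t" "\<And>z. t < z \<Longrightarrow> z < c \<Longrightarrow> P z"
    unfolding eventually_at_right_field by auto
  obtain q where "q \<in> \<rat>" "t < q" "q < min b c"
    using Rats_dense_in_real[of t "min b c"] True c(1) by auto
  with that[of q] assms c show thesis by (auto simp: dense_times_def)
qed

text \<open>Move \<open>s\<close> to the right with \<open>t\<close> fixed, staying below
  \<open>t\<close>; then move \<open>t\<close> to the right. The order of the two times survives,
  and each move keeps the distance in the open set \<open>U\<close>.\<close>

lemma ex_pair_dense:
  assumes "\<omega> \<in> space M" "0 \<le> a" "a \<le> b" "open U"
  shows "(\<exists>s t. a \<le> s \<and> s \<le> t \<and> t \<le> b \<and> d (y s \<omega>) (y t \<omega>) \<in> U) \<longleftrightarrow>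
    (\<exists>s\<in>dense_times a b. \<exists>t\<in>dense_times a b. a \<le> s \<and> s \<le> t \<and> t \<le> b \<and> d (y s \<omega>) (y t \<omega>) \<in> U)"
proof
  assume "\<exists>s t. a \<le> s \<and> s \<le> t \<and> t \<le> b \<and> d (y s \<omega>) (y t \<omega>) \<in> U"
  then obtain s t where st: "a \<le> s" "s \<le> t" "t \<le> b" "d (y s \<omega>) (y t \<omega>) \<in> U" by auto
  show "\<exists>s\<in>dense_times a b. \<exists>t\<in>dense_times a b. a \<le> s \<and> s \<le> t \<and> t \<le> b \<and> d (y s \<omega>) (y t \<omega>) \<in> U"
  proof (cases "s = t")
    case True
    \<comment> \<open>The pair \<open>(b, b)\<close> realises distance 0 as well.\<close>
    with st assms show ?thesis by (auto simp: dense_times_def intro!: bexI[of _ b])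
  next
    case False
    then have "s < t" using st by simp
    have "eventually (\<lambda>q. q < t \<and> d (y q \<omega>) (y t \<omega>) \<in> U) (at_right s)"
      using topological_tendstoD[OF dist_tendsto_right[OF assms(1), of s "y t \<omega>"] assms(4)]
        st assms eventually_at_right_less eventually_at_right_real[OF \<open>s < t\<close>]
      by (auto elim: eventually_elim2)
    from dense_times_approx[OF _ _ _ this, of a b] \<open>s < t\<close> st
    obtain q where q: "q \<in> dense_times a b" "s \<le> q" "q < t" "d (y q \<omega>) (y t \<omega>) \<in> U" by force
    have "eventually (\<lambda>r. d (y q \<omega>) (y r \<omega>) \<in> U) (at_right t)"
      using topological_tendstoD[OF dist_tendsto_right[OF assms(1), of t "y q \<omega>"] assms(4)]
        st assms q by (simp add: dist.commute)
    from dense_times_approx[OF _ _ _ this, of a b] st q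
    obtain r where "r \<in> dense_times a b" "t \<le> r" "r \<le> b" "d (y q \<omega>) (y r \<omega>) \<in> U" by force
    with q st show ?thesis by (intro bexI[of _ q] bexI[of _ r]) auto
  qed
qed auto

lemma ex_from_dense:
  assumes "\<omega> \<in> space M" "0 \<le> a" "a \<le> b" "open U"
  shows "(\<exists>t\<in>{a..b}. d (y a \<omega>) (y t \<omega>) \<in> U) \<longleftrightarrow>
    (\<exists>t\<in>dense_times a b. a \<le> t \<and> t \<le> b \<and> d (y a \<omega>) (y t \<omega>) \<in> U)"
proof
  assume "\<exists>t\<in>{a..b}. d (y a \<omega>) (y t \<omega>) \<in> U"
  then obtain t where t: "a \<le> t" "t \<le> b" "d (y a \<omega>) (y t \<omega>) \<in> U" by auto
  have "eventually (\<lambda>r. d (y a \<omega>) (y r \<omega>) \<in> U) (at_right t)"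
    using topological_tendstoD[OF dist_tendsto_right[OF assms(1), of t "y a \<omega>"] assms(4)]
      t assms by (simp add: dist.commute)
  from dense_times_approx[OF t(1) t(2) t(3) this]
  obtain q where "q \<in> dense_times a b" "t \<le> q" "q \<le> b" "d (y a \<omega>) (y q \<omega>) \<in> U" by blast
  with t(1) show "\<exists>t\<in>dense_times a b. a \<le> t \<and> t \<le> b \<and> d (y a \<omega>) (y t \<omega>) \<in> U"
    by (intro bexI[of _ q]) auto
qed auto

text \<open>A general open \<open>U\<close> covers both uses: oscillation events, where
  \<open>U\<close> is a half-line, and the level sets of \<open>sup_exp\<close>.\<close>

lemma pair_event_sets:
  assumes "0 \<le> a" "a \<le> b" "open U"
  shows "{\<omega> \<in> space M. \<exists>s t. a \<le> s \<and> s \<le> t \<and> t \<le> b \<and> d (y s \<omega>) (y t \<omega>) \<in> U} \<in> sets (F a b)"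
proof -
  define R where "R \<omega> s t \<longleftrightarrow> a \<le> s \<and> s \<le> t \<and> t \<le> b \<and> d (y s \<omega>) (y t \<omega>) \<in> U" for \<omega> s t
  have "(\<exists>s t. R \<omega> s t) \<longleftrightarrow> (\<exists>s\<in>dense_times a b. \<exists>t\<in>dense_times a b. R \<omega> s t)" if "\<omega> \<in> space M" for \<omega>
    unfolding R_def using that assms by (rule ex_pair_dense)
  then have "{\<omega> \<in> space M. \<exists>s t. R \<omega> s t} =
      (\<Union>s\<in>dense_times a b. \<Union>t\<in>dense_times a b. {\<omega> \<in> space M. R \<omega> s t})"
    by blast
  also have "\<dots> \<in> sets (F a b)"
  proof (rule sets.countable_UN''[OF countable_dense_times], rule sets.countable_UN''[OF countable_dense_times])
    fix s t
    show "{\<omega> \<in> space M. R \<omega> s t} \<in> sets (F a b)"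
    proof (cases "a \<le> s \<and> s \<le> t \<and> t \<le> b")
      case True
      then have "{\<omega> \<in> space M. R \<omega> s t} = {\<omega> \<in> space M. d (y s \<omega>) (y t \<omega>) \<in> U}"
        unfolding R_def by blast
      moreover have "\<dots> \<in> sets (F a b)"
        using True assms by (intro dist_sets borel_open) blast+
      ultimately show ?thesis by (rule ssubst)
    next
      case False
      then have "{\<omega> \<in> space M. R \<omega> s t} = {}" unfolding R_def by blast
      then show ?thesis by (simp only: sets.empty_sets)
    qed
  qed
  finally show ?thesis unfolding R_def .
qed

text \<open>The strict inequality is an open condition on the distance, so countably many times
  decide it. The exit event, which compares with the starting value only, obeys a recursion in the
  level; the oscillation event is monotone in the interval and supplies the factor in that
  recursion.\<close>

definition osc_event :: "real \<Rightarrow> real \<Rightarrow> real \<Rightarrow> 'w set" where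
  "osc_event a b K = {\<omega> \<in> space M. \<exists>s t. a \<le> s \<and> s \<le> t \<and> t \<le> b \<and> K < d (y s \<omega>) (y t \<omega>)}"

definition exit_event :: "real \<Rightarrow> real \<Rightarrow> real \<Rightarrow> 'w set" where
  "exit_event a b K = {\<omega> \<in> space M. \<exists>t\<in>{a..b}. K < d (y a \<omega>) (y t \<omega>)}"

lemma osc_event_sets: "0 \<le> a \<Longrightarrow> a \<le> b \<Longrightarrow> osc_event a b K \<in> sets (F a b)"
  using pair_event_sets[of a b "{K<..}"] by (simp add: osc_event_def)

lemma exit_event_sets:
  assumes "0 \<le> a" "a \<le> b"
  shows "exit_event a b K \<in> sets (F a b)"
proof -
  define R where "R \<omega> t \<longleftrightarrow> a \<le> t \<and> t \<le> b \<and> d (y a \<omega>) (y t \<omega>) \<in> {K<..}" for \<omega> t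
  have "(\<exists>t. R \<omega> t) \<longleftrightarrow> (\<exists>t\<in>dense_times a b. R \<omega> t)" if "\<omega> \<in> space M" for \<omega>
    using ex_from_dense[OF that assms open_greaterThan] unfolding R_def Bex_def atLeastAtMost_iff conj_assoc .
  then have "{\<omega> \<in> space M. \<exists>t. R \<omega> t} = (\<Union>t\<in>dense_times a b. {\<omega> \<in> space M. R \<omega> t})"
    by blast
  also have "\<dots> \<in> sets (F a b)"
  proof (rule sets.countable_UN''[OF countable_dense_times])
    fix t
    show "{\<omega> \<in> space M. R \<omega> t} \<in> sets (F a b)"
    proof (cases "a \<le> t \<and> t \<le> b")
      case True
      then have "{\<omega> \<in> space M. R \<omega> t} = {\<omega> \<in> space M. d (y a \<omega>) (y t \<omega>) \<in> {K<..}}"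
        unfolding R_def by blast
      moreover have "\<dots> \<in> sets (F a b)"
        using True assms by (intro dist_sets borel_open open_greaterThan) auto
      ultimately show ?thesis by (rule ssubst)
    next
      case False
      then have "{\<omega> \<in> space M. R \<omega> t} = {}" unfolding R_def by blast
      then show ?thesis by (simp only: sets.empty_sets)
    qed
  qed
  finally show ?thesis
    unfolding R_def exit_event_def Bex_def atLeastAtMost_iff conj_assoc greaterThan_iff .
qed

lemma osc_event_events [measurable]: "0 \<le> a \<Longrightarrow> a \<le> b \<Longrightarrow> osc_event a b K \<in> events"
  using osc_event_sets sets_F_subset by blast

lemma exit_event_events [measurable]: "0 \<le> a \<Longrightarrow> a \<le> b \<Longrightarrow> exit_event a b K \<in> events"
  using exit_event_sets sets_F_subset by blast

lemma osc_event_mono: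
  assumes "a \<le> a'" "b' \<le> b"
  shows "osc_event a' b' K \<subseteq> osc_event a b K"
proof
  fix \<omega> assume "\<omega> \<in> osc_event a' b' K"
  then obtain s t where "\<omega> \<in> space M" "a' \<le> s" "s \<le> t" "t \<le> b'" "K < d (y s \<omega>) (y t \<omega>)"
    unfolding osc_event_def by blast
  moreover from this assms have "a \<le> s" "t \<le> b" by linarith+
  ultimately show "\<omega> \<in> osc_event a b K"
    unfolding osc_event_def by blast
qed

lemma exit_event_subset_osc: "exit_event a b K \<subseteq> osc_event a b K"
proof
  fix \<omega> assume "\<omega> \<in> exit_event a b K"
  then obtain t where "\<omega> \<in> space M" "a \<le> t" "t \<le> b" "K < d (y a \<omega>) (y t \<omega>)"
    unfolding exit_event_def by auto
  moreover have "a \<le> a" by simp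
  ultimately show "\<omega> \<in> osc_event a b K"
    unfolding osc_event_def by blast
qed

subsection \<open>Local oscillation of a path\<close>

text \<open>Values shortly after \<open>t\<close> are close to \<open>y t \<omega>\<close>, values
  shortly before it close to \<open>l\<close>; only a pair separated by \<open>t\<close> pays the
  jump \<open>J\<close>. Used with \<open>J = C\<close> to control the steps of almost every path,
  and with \<open>J = 0\<close> and \<open>l = y t \<omega>\<close> at a time where the path does
  not jump.\<close>

lemma local_oscillation:
  assumes \<omega>: "\<omega> \<in> space M" and t: "0 \<le> t" and \<eta>: "0 < \<eta>" and J: "0 \<le> J"
    and jump: "t > 0 \<Longrightarrow> ((\<lambda>s. d (y s \<omega>) l) \<longlongrightarrow> 0) (at_left t)"
    and l: "t > 0 \<Longrightarrow> d l (y t \<omega>) \<le> J"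
  obtains \<delta> where "\<delta> > 0"
    "\<And>s s'. 0 \<le> s \<Longrightarrow> 0 \<le> s' \<Longrightarrow> \<bar>s - t\<bar> < \<delta> \<Longrightarrow> \<bar>s' - t\<bar> < \<delta> \<Longrightarrow> d (y s \<omega>) (y s' \<omega>) \<le> J + \<eta>"
proof -
  have "eventually (\<lambda>s. d (y s \<omega>) (y t \<omega>) < \<eta>/2) (at_right t)"
    using order_tendstoD(2)[OF right_cont[OF \<omega> t], of "\<eta>/2"] \<eta> by simp
  then obtain c where c: "c > t" "\<And>s. t < s \<Longrightarrow> s < c \<Longrightarrow> d (y s \<omega>) (y t \<omega>) < \<eta>/2"
    unfolding eventually_at_right_field by auto
  have "\<exists>b<t. t > 0 \<longrightarrow> (\<forall>s. b < s \<and> s < t \<longrightarrow> d (y s \<omega>) l < \<eta>/2)"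
  proof (cases "t > 0")
    case True
    then have "eventually (\<lambda>s. d (y s \<omega>) l < \<eta>/2) (at_left t)"
      using order_tendstoD(2)[OF jump, of "\<eta>/2"] \<eta> by simp
    then show ?thesis unfolding eventually_at_left_field by auto
  \<comment> \<open>At time 0 there are no admissible times to the left, so any \<open>b\<close>
    below \<open>t\<close> serves.\<close>
  qed (auto intro: exI[of _ "t - 1"])
  then obtain b where b: "b < t" "\<And>s. t > 0 \<Longrightarrow> b < s \<Longrightarrow> s < t \<Longrightarrow> d (y s \<omega>) l < \<eta>/2" by auto
  have right: "d (y s \<omega>) (y t \<omega>) < \<eta>/2" if "t \<le> s" "s < c" for s
    using c(2)[of s] that \<eta> by (cases "s = t") auto
  show thesis
  proof (rule that[of "min (c - t) (t - b)"])
    show "0 < min (c - t) (t - b)" using b c by auto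
    fix s s' assume s: "0 \<le> s" "0 \<le> s'" "\<bar>s - t\<bar> < min (c - t) (t - b)" "\<bar>s' - t\<bar> < min (c - t) (t - b)"
    consider "t \<le> s" "t \<le> s'" | "t \<le> s" "s' < t" | "s < t" "t \<le> s'" | "s < t" "s' < t"
      by linarith
    then show "d (y s \<omega>) (y s' \<omega>) \<le> J + \<eta>"
    proof cases
      case 1
      then show ?thesis
        using right[of s] right[of s'] s d_triangle[of "y s \<omega>" "y s' \<omega>" "y t \<omega>"] J
          dist.commute[of "y s' \<omega>" "y t \<omega>"] by linarith
    next
      case 2
      then show ?thesis
        using right[of s] b(2)[of s'] l s d_triangle[of "y s \<omega>" "y s' \<omega>" "y t \<omega>"]
          d_triangle[of "y t \<omega>" "y s' \<omega>" l] dist.commute[of l "y t \<omega>"] dist.commute[of l "y s' \<omega>"] by linarith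
    next
      case 3
      then show ?thesis
        using right[of s'] b(2)[of s] l s d_triangle[of "y s \<omega>" "y s' \<omega>" "y t \<omega>"]
          d_triangle[of "y s \<omega>" "y t \<omega>" l] dist.commute[of "y s' \<omega>" "y t \<omega>"] by linarith
    next
      case 4
      then show ?thesis
        using b(2)[of s] b(2)[of s'] s d_triangle[of "y s \<omega>" "y s' \<omega>" l] J
          dist.commute[of "y s' \<omega>" l] by linarith
    qed
  qed
qed

text \<open>A path with jumps has no modulus of continuity, but with jumps of size at most
  \<open>C\<close> a compact interval has a scale \<open>h\<close> at which it moves by at most
  \<open>C + 1\<close>. This scale depends on the path.\<close>

lemma small_mesh_modulus:
  assumes \<omega>: "\<omega> \<in> space M" and "0 \<le> a"
    and jump: "\<forall>t>0. \<forall>l. ((\<lambda>s. d (y s \<omega>) l) \<longlongrightarrow> 0) (at_left t) \<longrightarrow> d l (y t \<omega>) \<le> C"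
  obtains h where "h > 0"
    "\<And>s t. a \<le> s \<Longrightarrow> s \<le> t \<Longrightarrow> t \<le> b \<Longrightarrow> t - s < h \<Longrightarrow> d (y s \<omega>) (y t \<omega>) \<le> C + 1"
proof -
  define Q where "Q t \<delta> \<longleftrightarrow> (\<forall>s s'. 0 \<le> s \<longrightarrow> 0 \<le> s' \<longrightarrow> \<bar>s - t\<bar> < \<delta> \<longrightarrow> \<bar>s' - t\<bar> < \<delta> \<longrightarrow>
      d (y s \<omega>) (y s' \<omega>) \<le> C + 1)" for t \<delta>
  have "\<exists>\<delta>>0. Q t \<delta>" if "a \<le> t" "t \<le> b" for t
  proof -
    obtain l where l: "t > 0 \<Longrightarrow> ((\<lambda>s. d (y s \<omega>) l) \<longlongrightarrow> 0) (at_left t)"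
      using left_limit[OF \<omega>, of t] by (cases "t > 0") auto
    have "t > 0 \<Longrightarrow> d l (y t \<omega>) \<le> C"
      using jump l by blast
    note jump_t = this
    have "0 \<le> t" using that \<open>0 \<le> a\<close> by linarith
    show ?thesis
    proof (rule local_oscillation[OF \<omega> \<open>0 \<le> t\<close> zero_less_one C_nonneg l jump_t])
      fix \<delta> :: real assume "\<delta> > 0" and "\<And>s s'. 0 \<le> s \<Longrightarrow> 0 \<le> s' \<Longrightarrow> \<bar>s - t\<bar> < \<delta> \<Longrightarrow> \<bar>s' - t\<bar> < \<delta> \<Longrightarrow>
        d (y s \<omega>) (y s' \<omega>) \<le> C + 1"
      then show "\<exists>\<delta>>0. Q t \<delta>" unfolding Q_def by (intro exI[of _ \<delta>]) simp
    qed
  qed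
  then have "\<exists>h>0. \<forall>s\<in>{a..b}. \<exists>t\<in>{a..b}. \<exists>\<delta>>0. Q t \<delta> \<and> ball s h \<subseteq> ball t \<delta>"
    by (rule lebesgue_number_Icc)
  then obtain h where h: "h > 0" and
    *: "\<And>s. s \<in> {a..b} \<Longrightarrow> \<exists>t\<in>{a..b}. \<exists>\<delta>>0. Q t \<delta> \<and> ball s h \<subseteq> ball t \<delta>"
    by blast
  have "d (y s \<omega>) (y t \<omega>) \<le> C + 1" if st: "a \<le> s" "s \<le> t" "t \<le> b" "t - s < h" for s t
  proof -
    have "s \<in> {a..b}" using st by simp
    from *[OF this] obtain r \<delta> where r: "Q r \<delta>" and sub: "ball s h \<subseteq> ball r \<delta>" by blast
    have "s \<in> ball s h" "t \<in> ball s h"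
      using st h by (simp_all add: dist_real_def)
    with sub have "s \<in> ball r \<delta>" "t \<in> ball r \<delta>" by blast+
    then have "\<bar>s - r\<bar> < \<delta>" "\<bar>t - r\<bar> < \<delta>" by (simp_all add: dist_real_def abs_minus_commute)
    moreover have "0 \<le> s" "0 \<le> t" using st \<open>0 \<le> a\<close> by linarith+
    ultimately show ?thesis
      using r unfolding Q_def by blast
  qed
  with h that show thesis by blast
qed

subsection \<open>Geometric tails and exponential moments\<close>

definition grid :: "real \<Rightarrow> real \<Rightarrow> nat \<Rightarrow> nat \<Rightarrow> real" where
  "grid a b n i = a + (b - a) * real i / real (Suc n)"

lemma grid_0 [simp]: "grid a b n 0 = a"
  by (simp add: grid_def)

lemma grid_last [simp]: "grid a b n (Suc n) = b"
  by (simp add: grid_def)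

lemma grid_mono: "a \<le> b \<Longrightarrow> i \<le> j \<Longrightarrow> grid a b n i \<le> grid a b n j"
  unfolding grid_def by (intro add_left_mono divide_right_mono mult_left_mono) auto

lemma grid_step: "grid a b n (Suc i) - grid a b n i = (b - a) / real (Suc n)"
  unfolding grid_def by (simp add: field_simps del: of_nat_Suc) (simp add: algebra_simps)

lemma grid_bounds:
  assumes "a \<le> b" "i \<le> Suc n"
  shows "a \<le> grid a b n i" "grid a b n i \<le> b"
  using grid_mono[OF assms(1), of 0 i n] grid_mono[OF assms, of n] by simp_all

lemma grid_hits:
  assumes t: "a \<le> t" "t < b" and h: "(b - a) / real (Suc n) < h"
  obtains i where "i \<le> Suc n" "t \<le> grid a b n i" "grid a b n i < t + h"
proof -
  define i where "i = (LEAST i. t \<le> grid a b n i)"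
  have ex: "t \<le> grid a b n (Suc n)" using t by simp
  have "t \<le> grid a b n i" unfolding i_def using ex by (rule LeastI)
  moreover have "i \<le> Suc n" unfolding i_def using ex by (rule Least_le)
  moreover have "grid a b n i < t + h"
  proof (cases i)
    case 0
    have "0 < (b - a) / real (Suc n)" using t by simp
    then have "0 < h" using h by linarith
    then show ?thesis using 0 t by simp
  next
    case (Suc j)
    then have "\<not> t \<le> grid a b n j" using not_less_Least[of j "\<lambda>i. t \<le> grid a b n i"] i_def by simp
    then show ?thesis using grid_step[of a b n j] h Suc by simp
  qed
  ultimately show thesis using that by blast
qed

lemma mesh_small:
  assumes "h > (0::real)"
  shows "eventually (\<lambda>n. (b - a) / real (Suc n) < h) sequentially"
proof -
  have "(\<lambda>n. (b - a) / real (Suc n)) \<longlonglongrightarrow> 0"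
    by (intro tendsto_divide_0[OF tendsto_const] filterlim_at_top_imp_at_infinity
          filterlim_compose[OF filterlim_real_sequentially filterlim_Suc])
  from order_tendstoD(2)[OF this assms] show ?thesis .
qed

text \<open>The clause on single steps puts the overshoot bound into the event itself, so that the
  probability estimate is a finite argument for each grid. Almost every path satisfies the clause on
  all fine grids.\<close>

definition grid_exit_event :: "real \<Rightarrow> real \<Rightarrow> real \<Rightarrow> nat \<Rightarrow> 'w set" where
  "grid_exit_event a b \<mu> n = {\<omega> \<in> space M.
     (\<exists>j\<in>{..Suc n}. \<mu> < d (y a \<omega>) (y (grid a b n j) \<omega>)) \<and>
     (\<forall>i\<in>{..n}. d (y (grid a b n i) \<omega>) (y (grid a b n (Suc i)) \<omega>) \<le> C + 1)}"

lemma dist_measurable_M: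
  assumes "0 \<le> s" "s \<le> t"
  shows "(\<lambda>\<omega>. d (y s \<omega>) (y t \<omega>)) \<in> borel_measurable M"
  using measurable_from_subalg[OF F_subalgebra dist_measurable] assms by blast

lemma grid_exit_event_events:
  assumes "0 \<le> a" "a \<le> b"
  shows "grid_exit_event a b \<mu> n \<in> events"
proof -
  have "{\<omega> \<in> space M. \<mu> < d (y a \<omega>) (y (grid a b n j) \<omega>)} \<in> events" for j
    using grid_mono[of a b 0 j n] assms
    by (intro borel_measurable_less borel_measurable_const dist_measurable_M) simp_all
  moreover have "{\<omega> \<in> space M. d (y (grid a b n i) \<omega>) (y (grid a b n (Suc i)) \<omega>) \<le> C + 1} \<in> events" for i
    using grid_mono[of a b 0 i n] grid_mono[of a b i "Suc i" n] assms
    by (intro borel_measurable_le borel_measurable_const dist_measurable_M) simp_all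
  ultimately show ?thesis
    unfolding grid_exit_event_def
    by (intro sets.sets_Collect_conj sets.sets_Collect_finite_Ex sets.sets_Collect_finite_All finite_atMost)
qed

text \<open>By right-continuity an exceedance at \<open>t < b\<close> persists on some
  \<open>[t, c)\<close>, which every fine grid meets inside \<open>[a, b]\<close>; \<open>b\<close>
  itself is always a grid point. The bound on the steps is
  \<open>small_mesh_modulus\<close>.\<close>

lemma eventually_grid_exit:
  assumes \<omega>: "\<omega> \<in> exit_event a b \<mu>" and ab: "0 \<le> a" "a \<le> b"
    and jump: "\<forall>t>0. \<forall>l. ((\<lambda>s. d (y s \<omega>) l) \<longlongrightarrow> 0) (at_left t) \<longrightarrow> d l (y t \<omega>) \<le> C"
  shows "eventually (\<lambda>n. \<omega> \<in> grid_exit_event a b \<mu> n) sequentially"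
proof -
  have sp: "\<omega> \<in> space M" using \<omega> by (simp add: exit_event_def)
  from \<omega> obtain t where t: "a \<le> t" "t \<le> b" "\<mu> < d (y a \<omega>) (y t \<omega>)"
    by (auto simp: exit_event_def)
  have "0 \<le> t" using t ab by linarith
  obtain h where h: "h > 0"
    "\<And>s t. a \<le> s \<Longrightarrow> s \<le> t \<Longrightarrow> t \<le> b \<Longrightarrow> t - s < h \<Longrightarrow> d (y s \<omega>) (y t \<omega>) \<le> C + 1"
    using small_mesh_modulus[OF sp ab(1) jump] by blast
  have "eventually (\<lambda>r. \<mu> < d (y r \<omega>) (y a \<omega>)) (at_right t)"
    using order_tendstoD(1)[OF dist_tendsto_right[OF sp \<open>0 \<le> t\<close>], of \<mu> "y a \<omega>"] t
    by (simp add: dist.commute[of "y a \<omega>"])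
  then obtain c where c: "t < c" "\<And>r. t < r \<Longrightarrow> r < c \<Longrightarrow> \<mu> < d (y r \<omega>) (y a \<omega>)"
    unfolding eventually_at_right_field by blast
  from mesh_small[OF h(1), of b a] mesh_small[of "c - t" b a] c(1)
  have "eventually (\<lambda>n. (b - a) / real (Suc n) < h \<and> (b - a) / real (Suc n) < c - t) sequentially"
    by (simp add: eventually_conj)
  then show ?thesis
  proof eventually_elim
    case (elim n)
    have "\<exists>j\<in>{..Suc n}. \<mu> < d (y a \<omega>) (y (grid a b n j) \<omega>)"
    proof (cases "t < b")
      case False
      with t have "t = b" by simp
      with t show ?thesis by (intro bexI[of _ "Suc n"]) auto
    next
      case True
      from grid_hits[OF t(1) this conjunct2[OF elim]] obtain i where
        i: "i \<le> Suc n" "t \<le> grid a b n i" "grid a b n i < t + (c - t)" .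
      have "\<mu> < d (y a \<omega>) (y (grid a b n i) \<omega>)"
      proof (cases "t = grid a b n i")
        case True with t show ?thesis by simp
      next
        case False
        then have "\<mu> < d (y (grid a b n i) \<omega>) (y a \<omega>)" using i by (intro c) auto
        then show ?thesis by (simp only: dist.commute)
      qed
      with i show ?thesis by blast
    qed
    moreover have "d (y (grid a b n i) \<omega>) (y (grid a b n (Suc i)) \<omega>) \<le> C + 1" if "i \<le> n" for i
    proof (rule h(2))
      show "a \<le> grid a b n i" "grid a b n (Suc i) \<le> b" using grid_bounds ab that by simp_all
      show "grid a b n i \<le> grid a b n (Suc i)" using grid_mono ab by simp
      show "grid a b n (Suc i) - grid a b n i < h" using elim by (simp add: grid_step del: of_nat_Suc)
    qed
    ultimately show ?case using sp unfolding grid_exit_event_def by blast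
  qed
qed

text \<open>
  First passage over level \<open>\<mu>\<close> along the grid overshoots by at most the size \<open>C + 1\<close> of one grid
  step, so passing \<open>\<mu> + K + (C + 1)\<close> requires a further oscillation larger than \<open>K\<close>, which is independent
  of the past.
\<close>

lemma prob_grid_exit_le:
  assumes ab: "0 \<le> a" "a \<le> b" and "0 \<le> \<mu>" "0 \<le> K"
  shows "prob (grid_exit_event a b (\<mu> + (K + C + 1)) n) \<le> prob (exit_event a b \<mu>) * prob (osc_event a b K)"
proof -
  define g where "g = grid a b n"
  have g0: "g 0 = a" and gb: "\<And>i. i \<le> Suc n \<Longrightarrow> a \<le> g i" "\<And>i. i \<le> Suc n \<Longrightarrow> g i \<le> b"
    and gm: "\<And>i j. i \<le> j \<Longrightarrow> g i \<le> g j"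
    using grid_bounds grid_mono ab by (auto simp: g_def)
  \<comment> \<open>\<open>P i\<close> is first passage at grid index \<open>i\<close>, the
    substitute for a passage time; it is decided by time \<open>g i\<close>, and the oscillation
    event over \<open>[g i, b]\<close> is independent of it.\<close>
  define P where "P i = {\<omega> \<in> space M. \<mu> < d (y a \<omega>) (y (g i) \<omega>) \<and>
      (\<forall>j<i. d (y a \<omega>) (y (g j) \<omega>) \<le> \<mu>)}" for i
  have P_sets: "P i \<in> sets (F a (g i))" if "i \<le> Suc n" for i
  proof -
    have *: "{\<omega> \<in> space M. d (y a \<omega>) (y (g j) \<omega>) \<in> B} \<in> sets (F a (g i))" if "B \<in> sets borel" "j \<le> i" for j B
      using ab that gm[of j i] gb[of j] \<open>i \<le> Suc n\<close> by (intro dist_sets) auto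
    \<comment> \<open>For \<open>i = 0\<close> the intersection over no indices is
      \<open>UNIV\<close>; the factor \<open>space M\<close> keeps it inside the
      sigma-algebra.\<close>
    have "P i = {\<omega> \<in> space M. d (y a \<omega>) (y (g i) \<omega>) \<in> {\<mu><..}} \<inter>
        (\<Inter>j\<in>{..<i}. {\<omega> \<in> space M. d (y a \<omega>) (y (g j) \<omega>) \<in> {..\<mu>}}) \<inter> space M"
      unfolding P_def by auto
    also have "\<dots> = {\<omega> \<in> space M. d (y a \<omega>) (y (g i) \<omega>) \<in> {\<mu><..}} \<inter>
        (space M \<inter> (\<Inter>j\<in>{..<i}. {\<omega> \<in> space M. d (y a \<omega>) (y (g j) \<omega>) \<in> {..\<mu>}}))"
      by blast
    also have "\<dots> \<in> sets (F a (g i))"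
    proof (rule sets.Int)
      show "{\<omega> \<in> space M. d (y a \<omega>) (y (g i) \<omega>) \<in> {\<mu><..}} \<in> sets (F a (g i))"
        by (rule *) auto
      have "space M = space (F a (g i))" using ab gb that by simp
      moreover have "space (F a (g i)) \<inter> (\<Inter>j\<in>{..<i}. {\<omega> \<in> space M. d (y a \<omega>) (y (g j) \<omega>) \<in> {..\<mu>}}) \<in> sets (F a (g i))"
      proof (cases "i = 0")
        case False
        then show ?thesis by (intro sets.Int sets.top sets.finite_INT *) auto
      qed simp
      ultimately show "space M \<inter> (\<Inter>j\<in>{..<i}. {\<omega> \<in> space M. d (y a \<omega>) (y (g j) \<omega>) \<in> {..\<mu>}}) \<in> sets (F a (g i))"
        by simp
    qed
    finally show ?thesis .
  qed
  have O_sets: "osc_event (g i) b K \<in> sets (F (g i) b)" if "i \<le> Suc n" for i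
    using gb[OF that] ab by (intro osc_event_sets) auto
  have P_ev: "P i \<in> events" if "i \<le> Suc n" for i
    using P_sets[OF that] sets_F_subset[of a "g i"] gb[OF that] ab by auto
  have O_ev: "osc_event (g i) b K \<in> events" if "i \<le> Suc n" for i
    using gb[OF that] ab by (intro osc_event_events) auto
  have PO: "prob (P i \<inter> osc_event (g i) b K) = prob (P i) * prob (osc_event (g i) b K)" if "i \<le> Suc n" for i
    using indep_setD[OF indep_F P_sets O_sets] ab gb that by simp
  have sub: "grid_exit_event a b (\<mu> + (K + C + 1)) n \<subseteq> (\<Union>i\<in>{..Suc n}. P i \<inter> osc_event (g i) b K)"
  proof
    fix \<omega> assume "\<omega> \<in> grid_exit_event a b (\<mu> + (K + C + 1)) n"
    then obtain j where sp: "\<omega> \<in> space M" and j: "j \<le> Suc n" "\<mu> + (K + C + 1) < d (y a \<omega>) (y (g j) \<omega>)"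
      and step: "\<And>i. i \<le> n \<Longrightarrow> d (y (g i) \<omega>) (y (g (Suc i)) \<omega>) \<le> C + 1"
      unfolding grid_exit_event_def g_def by auto
    show "\<omega> \<in> (\<Union>i\<in>{..Suc n}. P i \<inter> osc_event (g i) b K)"
    proof -
      define i where "i = (LEAST i. \<mu> < d (y a \<omega>) (y (g i) \<omega>))"
      have ex: "\<mu> < d (y a \<omega>) (y (g j) \<omega>)" using j \<open>0 \<le> K\<close> C_nonneg by linarith
      have i: "\<mu> < d (y a \<omega>) (y (g i) \<omega>)" unfolding i_def using ex by (rule LeastI)
      have ij: "i \<le> j" unfolding i_def using ex by (rule Least_le)
      have below: "d (y a \<omega>) (y (g k) \<omega>) \<le> \<mu>" if "k < i" for k
        using not_less_Least[of k "\<lambda>i. \<mu> < d (y a \<omega>) (y (g i) \<omega>)"] that i_def by (simp add: not_less)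
      \<comment> \<open>The path starts at distance 0 from itself, so the level is not yet passed at
        index 0 and a preceding grid point exists.\<close>
      have "i \<noteq> 0" using i \<open>0 \<le> \<mu>\<close> by (metis g0 d_self not_less)
      then obtain k where k: "i = Suc k" by (cases i) auto
      have "d (y a \<omega>) (y (g i) \<omega>) \<le> \<mu> + (C + 1)"
        using d_triangle[of "y a \<omega>" "y (g i) \<omega>" "y (g k) \<omega>"] below[of k] step[of k] k ij j by simp
      then have "K < d (y (g i) \<omega>) (y (g j) \<omega>)"
        using d_triangle[of "y a \<omega>" "y (g j) \<omega>" "y (g i) \<omega>"] j by linarith
      then have "\<omega> \<in> osc_event (g i) b K"
        unfolding osc_event_def using sp gm[OF ij] gb[of j] j by blast
      moreover have "\<omega> \<in> P i" unfolding P_def using sp i below by blast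
      ultimately show ?thesis using ij j by auto
    qed
  qed
  have disj: "disjoint_family_on P {..Suc n}"
    unfolding disjoint_family_on_def
  proof (intro ballI impI)
    fix i j :: nat assume "i \<noteq> j"
    then consider "i < j" | "j < i" by linarith
    then show "P i \<inter> P j = {}" by cases (auto simp: P_def)
  qed
  have "prob (grid_exit_event a b (\<mu> + (K + C + 1)) n) \<le> prob (\<Union>i\<in>{..Suc n}. P i \<inter> osc_event (g i) b K)"
    using sub P_ev O_ev by (intro finite_measure_mono) auto
  also have "\<dots> \<le> (\<Sum>i\<le>Suc n. prob (P i \<inter> osc_event (g i) b K))"
    using P_ev O_ev by (intro finite_measure_subadditive_finite) auto
  \<comment> \<open>Enlarging \<open>[g i, b]\<close> to \<open>[a, b]\<close> makes the second
    factor independent of \<open>i\<close>; the disjoint events \<open>P i\<close> then add up to at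
    most the exit event.\<close>
  also have "\<dots> \<le> (\<Sum>i\<le>Suc n. prob (P i) * prob (osc_event a b K))"
  proof (rule sum_mono)
    fix i assume "i \<in> {..Suc n}"
    then have "i \<le> Suc n" by simp
    then have "prob (osc_event (g i) b K) \<le> prob (osc_event a b K)"
      using gb ab by (intro finite_measure_mono osc_event_mono osc_event_events) auto
    then show "prob (P i \<inter> osc_event (g i) b K) \<le> prob (P i) * prob (osc_event a b K)"
      unfolding PO[OF \<open>i \<le> Suc n\<close>] by (intro mult_left_mono) auto
  qed
  also have "\<dots> = prob (\<Union>i\<in>{..Suc n}. P i) * prob (osc_event a b K)"
    using disj P_ev by (subst finite_measure_finite_Union) (auto simp: sum_distrib_right simp del: sum.atMost_Suc)
  also have "\<dots> \<le> prob (exit_event a b \<mu>) * prob (osc_event a b K)"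
  proof (intro mult_right_mono finite_measure_mono exit_event_events ab)
    show "(\<Union>i\<in>{..Suc n}. P i) \<subseteq> exit_event a b \<mu>"
      using gb unfolding P_def exit_event_def by force
  qed auto
  finally show ?thesis .
qed

text \<open>The grid estimate has the same right-hand side for every \<open>n\<close>, and almost
  every path in the exit event lies in all grid events from some \<open>n\<close> on.\<close>

lemma prob_exit_step:
  assumes "0 \<le> a" "a \<le> b" "0 \<le> \<mu>" "0 \<le> K"
  shows "prob (exit_event a b (\<mu> + (K + C + 1))) \<le> prob (exit_event a b \<mu>) * prob (osc_event a b K)"
proof (rule prob_le_of_eventually_mem)
  show "AE \<omega> in M. \<omega> \<in> exit_event a b (\<mu> + (K + C + 1)) \<longrightarrow>
      eventually (\<lambda>n. \<omega> \<in> grid_exit_event a b (\<mu> + (K + C + 1)) n) sequentially"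
    using jump_le by eventually_elim (use eventually_grid_exit assms in blast)
  show "grid_exit_event a b (\<mu> + (K + C + 1)) n \<in> events" for n
    using assms by (intro grid_exit_event_events)
  show "exit_event a b (\<mu> + (K + C + 1)) \<in> events"
    using assms by (intro exit_event_events)
  show "prob (grid_exit_event a b (\<mu> + (K + C + 1)) n) \<le> prob (exit_event a b \<mu>) * prob (osc_event a b K)" for n
    using assms by (intro prob_grid_exit_le)
qed

text \<open>Every further \<open>K + C + 1\<close> of distance, overshoot included, costs one more
  oscillation larger than \<open>K\<close>. The induction starts because an exit is itself such an
  oscillation.\<close>

lemma prob_exit_geometric:
  assumes "0 \<le> a" "a \<le> b" "0 \<le> K" "prob (osc_event a b K) \<le> p"
  shows "prob (exit_event a b (K + real n * (K + C + 1))) \<le> p ^ Suc n"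
proof (induction n)
  case 0
  have "prob (exit_event a b K) \<le> prob (osc_event a b K)"
    using assms exit_event_subset_osc by (intro finite_measure_mono osc_event_events) auto
  with assms show ?case by simp
next
  case (Suc n)
  have "0 \<le> p" using assms(4) measure_nonneg[of M "osc_event a b K"] by linarith
  have "prob (exit_event a b (K + real (Suc n) * (K + C + 1))) =
      prob (exit_event a b (K + real n * (K + C + 1) + (K + C + 1)))"
    by (simp add: algebra_simps)
  also have "\<dots> \<le> prob (exit_event a b (K + real n * (K + C + 1))) * prob (osc_event a b K)"
    using assms C_nonneg by (intro prob_exit_step) auto
  also have "\<dots> \<le> p ^ Suc n * p"
    using Suc assms \<open>0 \<le> p\<close> by (intro mult_mono) auto
  finally show ?case by (simp add: mult.commute)
qed

section \<open>The exponential supremum\<close>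

abbreviation sup_exp :: "real \<Rightarrow> real \<Rightarrow> real \<Rightarrow> 'w \<Rightarrow> ennreal" where
  "sup_exp \<alpha> a b \<equiv> \<lambda>\<omega>. sup_exp_dist d \<alpha> (\<lambda>t. y t \<omega>) a b"

text \<open>The supremum exceeds \<open>c\<close> exactly if some pair of times does, and that is an
  open condition on the distance.\<close>

lemma sup_exp_measurable_F:
  assumes "0 \<le> a" "a \<le> b"
  shows "sup_exp \<alpha> a b \<in> borel_measurable (F a b)"
proof (rule borel_measurableI_greater)
  fix c :: ennreal
  let ?O = "{v::real. c < ennreal (exp (\<alpha> * v))}"
  have "open ?O"
    by (intro open_Collect_less continuous_on_ennreal continuous_intros)
  have "{\<omega> \<in> space (F a b). c < sup_exp \<alpha> a b \<omega>} =
      {\<omega> \<in> space M. \<exists>s t. a \<le> s \<and> s \<le> t \<and> t \<le> b \<and> d (y s \<omega>) (y t \<omega>) \<in> ?O}"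
    using assms unfolding sup_exp_dist_def less_SUP_iff by simp
  with pair_event_sets[OF assms \<open>open ?O\<close>]
  show "{\<omega> \<in> space (F a b). c < sup_exp \<alpha> a b \<omega>} \<in> sets (F a b)" by (simp only:)
qed

lemma sup_exp_measurable:
  assumes "0 \<le> a" "a \<le> b"
  shows "sup_exp \<alpha> a b \<in> borel_measurable M"
  by (rule measurable_from_subalg[OF F_subalgebra sup_exp_measurable_F]) (use assms in auto)

lemma sup_exp_ge_1: "a \<le> b \<Longrightarrow> 1 \<le> sup_exp \<alpha> a b \<omega>"
  unfolding sup_exp_dist_def by (rule SUP_upper2[of "(a, a)"]) auto

lemma sup_exp_le_abs: "sup_exp \<alpha> a b \<omega> \<le> sup_exp \<bar>\<alpha>\<bar> a b \<omega>"
  unfolding sup_exp_dist_def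
  by (intro SUP_mono') (auto intro!: ennreal_leI mult_right_mono)

text \<open>With \<open>L = K + C + 1\<close>, two values at distance above
  \<open>2 * (K + n * L)\<close> cannot both be within \<open>K + n * L\<close> of
  \<open>y a \<omega>\<close>. So pairs are controlled by exits from the starting value, at the
  price of the factor 2 in the exponents.\<close>

lemma sup_exp_le_series:
  assumes "\<omega> \<in> space M" "0 \<le> \<alpha>" "0 \<le> K"
  shows "sup_exp \<alpha> a b \<omega> \<le> ennreal (exp (2 * \<alpha> * K)) *
    (1 + (\<Sum>n. indicator (exit_event a b (K + real n * (K + C + 1))) \<omega> *
                ennreal (exp (2 * \<alpha> * (K + C + 1)) ^ Suc n)))"
    (is "_ \<le> _ * (1 + (\<Sum>n. ?f n))")
  unfolding sup_exp_dist_def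
proof (rule SUP_least, clarify)
  fix s t assume st: "a \<le> s" "s \<le> t" "t \<le> b"
  define v where "v = d (y s \<omega>) (y t \<omega>)"
  define L where "L = K + C + 1"
  have "L > 0" using assms C_nonneg by (simp add: L_def)
  show "ennreal (exp (\<alpha> * d (y s \<omega>) (y t \<omega>))) \<le> ennreal (exp (2 * \<alpha> * K)) * (1 + (\<Sum>n. ?f n))"
    unfolding v_def[symmetric]
  proof (cases "v \<le> 2 * K")
    case True
    then have "exp (\<alpha> * v) \<le> exp (2 * \<alpha> * K)"
      using mult_left_mono[OF True \<open>0 \<le> \<alpha>\<close>] by (simp add: mult_ac)
    then have "ennreal (exp (\<alpha> * v)) \<le> ennreal (exp (2 * \<alpha> * K)) * 1"
      by (simp add: ennreal_leI)
    also have "\<dots> \<le> ennreal (exp (2 * \<alpha> * K)) * (1 + (\<Sum>n. ?f n))"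
      by (intro mult_left_mono) auto
    finally show "ennreal (exp (\<alpha> * v)) \<le> ennreal (exp (2 * \<alpha> * K)) * (1 + (\<Sum>n. ?f n))" .
  next
    case False
    \<comment> \<open>With \<open>n = m - 1\<close> this selects the layer
      \<open>2 * (K + n * L) < v \<le> 2 * (K + (n + 1) * L)\<close>; rounding up gives the strict
      lower bound that an exit requires.\<close>
    define m where "m = \<lceil>(v - 2 * K) / (2 * L)\<rceil>"
    have "m > 0" unfolding m_def using False \<open>L > 0\<close> by simp
    define n where "n = nat (m - 1)"
    have n: "real n = of_int m - 1" using \<open>m > 0\<close> by (simp add: n_def)
    have "real n < (v - 2 * K) / (2 * L)" "(v - 2 * K) / (2 * L) \<le> real n + 1"
      unfolding n m_def by linarith+
    then have lo: "2 * (K + real n * L) < v" and hi: "v \<le> 2 * K + 2 * L * real (Suc n)"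
      using \<open>L > 0\<close> by (simp_all add: field_simps)
    have "v \<le> d (y a \<omega>) (y s \<omega>) + d (y a \<omega>) (y t \<omega>)"
      unfolding v_def by (rule d_triangle2)
    then have "K + real n * L < d (y a \<omega>) (y s \<omega>) \<or> K + real n * L < d (y a \<omega>) (y t \<omega>)"
      using lo by (smt (verit))
    moreover have "s \<in> {a..b}" "t \<in> {a..b}" using st by auto
    ultimately have "\<omega> \<in> exit_event a b (K + real n * L)"
      unfolding exit_event_def using \<open>\<omega> \<in> space M\<close> by blast
    then have fn: "?f n = ennreal (exp (2 * \<alpha> * L) ^ Suc n)"
      by (simp add: L_def)
    have "exp (\<alpha> * v) \<le> exp (\<alpha> * (2 * K + 2 * L * real (Suc n)))"
      using mult_left_mono[OF hi \<open>0 \<le> \<alpha>\<close>] by simp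
    also have "\<dots> = exp (2 * \<alpha> * K) * exp (2 * \<alpha> * L) ^ Suc n"
      unfolding exp_of_nat_mult[symmetric] exp_add[symmetric] by (simp add: algebra_simps)
    finally have "ennreal (exp (\<alpha> * v)) \<le> ennreal (exp (2 * \<alpha> * K)) * ?f n"
      unfolding fn by (simp add: ennreal_mult[symmetric] ennreal_leI del: power_Suc)
    also have "\<dots> \<le> ennreal (exp (2 * \<alpha> * K)) * (1 + (\<Sum>n. ?f n))"
    proof (rule mult_left_mono)
      have "f n \<le> (\<Sum>n. f n)" for f :: "nat \<Rightarrow> ennreal"
        using sum_le_suminf[of f "{n}"] by simp
      then have "?f n \<le> (\<Sum>n. ?f n)" .
      also have "\<dots> \<le> 1 + (\<Sum>n. ?f n)" by simp
      finally show "?f n \<le> 1 + (\<Sum>n. ?f n)" .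
    qed simp
    finally show "ennreal (exp (\<alpha> * v)) \<le> ennreal (exp (2 * \<alpha> * K)) * (1 + (\<Sum>n. ?f n))" .
  qed
qed

text \<open>With \<open>q = exp (2 * \<alpha> * (K + C + 1))\<close>, the geometric tail sums the
  series to \<open>1 / (1 - p * q)\<close>. Taking first \<open>K\<close> and then \<open>p\<close>
  small brings the bound close to 1, so this one estimate serves both finiteness and the
  limit.\<close>

lemma nn_integral_sup_exp_le:
  assumes ab: "0 \<le> a" "a \<le> b" and "0 \<le> \<alpha>" "0 \<le> K"
    and p: "prob (osc_event a b K) \<le> p" and pq: "p * exp (2 * \<alpha> * (K + C + 1)) < 1"
  shows "(\<integral>\<^sup>+\<omega>. sup_exp \<alpha> a b \<omega> \<partial>M) \<le>
    ennreal (exp (2 * \<alpha> * K) / (1 - p * exp (2 * \<alpha> * (K + C + 1))))"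
proof -
  define q where "q = exp (2 * \<alpha> * (K + C + 1))"
  define E where "E n = exit_event a b (K + real n * (K + C + 1))" for n
  have "0 \<le> p" using p measure_nonneg[of M "osc_event a b K"] by linarith
  have "0 < q" by (simp add: q_def)
  have pq: "0 \<le> p * q" "p * q < 1" using pq \<open>0 \<le> p\<close> \<open>0 < q\<close> by (simp_all add: q_def)
  have [measurable]: "E n \<in> events" for n
    unfolding E_def using ab by (rule exit_event_events)
  have "(\<integral>\<^sup>+\<omega>. sup_exp \<alpha> a b \<omega> \<partial>M) \<le>
      (\<integral>\<^sup>+\<omega>. ennreal (exp (2 * \<alpha> * K)) * (1 + (\<Sum>n. indicator (E n) \<omega> * ennreal (q ^ Suc n))) \<partial>M)"
    unfolding E_def q_def using assms by (intro nn_integral_mono sup_exp_le_series)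
  also have "\<dots> = ennreal (exp (2 * \<alpha> * K)) * (1 + (\<Sum>n. emeasure M (E n) * ennreal (q ^ Suc n)))"
    by (simp add: nn_integral_cmult nn_integral_add nn_integral_suminf nn_integral_multc emeasure_space_1 del: power_Suc)
  also have "\<dots> \<le> ennreal (exp (2 * \<alpha> * K)) * (1 + (\<Sum>n. ennreal ((p * q) ^ Suc n)))"
  proof (intro mult_left_mono add_left_mono suminf_le)
    fix n
    have "prob (E n) * q ^ Suc n \<le> p ^ Suc n * q ^ Suc n"
      unfolding E_def using prob_exit_geometric[OF ab \<open>0 \<le> K\<close> p, of n] \<open>0 < q\<close>
      by (intro mult_right_mono) auto
    then have "ennreal (prob (E n) * q ^ Suc n) \<le> ennreal ((p * q) ^ Suc n)"
      by (simp add: ennreal_leI power_mult_distrib del: power_Suc)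
    then show "emeasure M (E n) * ennreal (q ^ Suc n) \<le> ennreal ((p * q) ^ Suc n)"
      using \<open>0 < q\<close> by (simp add: emeasure_eq_measure ennreal_mult del: power_Suc)
  qed auto
  also have "(\<Sum>n. ennreal ((p * q) ^ Suc n)) = ennreal (p * q * (1 / (1 - p * q)))"
  proof (rule suminf_ennreal_eq)
    show "(\<lambda>n. (p * q) ^ Suc n) sums (p * q * (1 / (1 - p * q)))"
      unfolding power_Suc using pq by (intro sums_mult geometric_sums) auto
  qed (use pq in auto)
  also have "ennreal (exp (2 * \<alpha> * K)) * (1 + ennreal (p * q * (1 / (1 - p * q)))) =
      ennreal (exp (2 * \<alpha> * K) * (1 + p * q * (1 / (1 - p * q))))"
    using pq by (simp add: ennreal_mult)
  also have "exp (2 * \<alpha> * K) * (1 + p * q * (1 / (1 - p * q))) = exp (2 * \<alpha> * K) / (1 - p * q)"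
    using pq by (simp add: field_simps)
  finally show ?thesis unfolding q_def .
qed

subsection \<open>Small time intervals\<close>

text \<open>A path that oscillates by more than \<open>K\<close> in every neighbourhood of
  \<open>t\<close> is discontinuous at \<open>t\<close>, which almost surely does not happen. Hence
  the events for shrinking neighbourhoods decrease to a null set.\<close>

lemma prob_osc_locally_small:
  assumes "0 \<le> t" "0 < K" "0 < p"
  shows "\<exists>\<delta>>0. prob (osc_event (max 0 (t - \<delta>)) (t + \<delta>) K) \<le> p"
proof -
  define B where "B n = osc_event (max 0 (t - 1 / real (Suc n))) (t + 1 / real (Suc n)) K" for n
  have B: "B n \<in> events" for n
    unfolding B_def using assms(1) by (intro osc_event_events) (auto simp: max_def)
  have "decseq B"
    unfolding B_def decseq_Suc_iff
  proof (intro allI osc_event_mono)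
    fix n
    have "1 / real (Suc (Suc n)) \<le> 1 / real (Suc n)" by (simp add: frac_le)
    then show "max 0 (t - 1 / real (Suc n)) \<le> max 0 (t - 1 / real (Suc (Suc n)))"
      "t + 1 / real (Suc (Suc n)) \<le> t + 1 / real (Suc n)" by auto
  qed
  then have lim: "(\<lambda>n. prob (B n)) \<longlonglongrightarrow> prob (\<Inter>n. B n)"
    using B by (intro finite_Lim_measure_decseq) auto
  have "AE \<omega> in M. 0 < t \<longrightarrow> ((\<lambda>s. d (y s \<omega>) (y t \<omega>)) \<longlongrightarrow> 0) (at_left t)"
    using no_fixed_jump[of t] by (cases "0 < t") auto
  then have "AE \<omega> in M. \<omega> \<notin> (\<Inter>n. B n)"
  proof (rule AE_mp, intro AE_I2 impI)
    fix \<omega> assume \<omega>: "\<omega> \<in> space M"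
      and lc: "0 < t \<longrightarrow> ((\<lambda>s. d (y s \<omega>) (y t \<omega>)) \<longlongrightarrow> 0) (at_left t)"
    have self: "0 < t \<Longrightarrow> d (y t \<omega>) (y t \<omega>) \<le> 0" by simp
    show "\<omega> \<notin> (\<Inter>n. B n)"
    proof (rule local_oscillation[OF \<omega> assms(1,2) order.refl lc[rule_format] self])
      fix \<delta> :: real assume "\<delta> > 0" and osc: "\<And>s s'. 0 \<le> s \<Longrightarrow> 0 \<le> s' \<Longrightarrow> \<bar>s - t\<bar> < \<delta> \<Longrightarrow>
        \<bar>s' - t\<bar> < \<delta> \<Longrightarrow> d (y s \<omega>) (y s' \<omega>) \<le> 0 + K"
      obtain n where n: "1 / real (Suc n) < \<delta>"
        using nat_approx_posE[OF \<open>\<delta> > 0\<close>] by blast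
      have "\<omega> \<notin> B n"
      proof
        assume "\<omega> \<in> B n"
        then obtain s s' where s: "max 0 (t - 1 / real (Suc n)) \<le> s" "s \<le> s'" "s' \<le> t + 1 / real (Suc n)"
          "K < d (y s \<omega>) (y s' \<omega>)" unfolding B_def osc_event_def by blast
        then have "0 \<le> s" "t - 1 / real (Suc n) \<le> s" by simp_all
        with s n have "0 \<le> s" "0 \<le> s'" "\<bar>s - t\<bar> < \<delta>" "\<bar>s' - t\<bar> < \<delta>" by linarith+
        from osc[OF this] s show False by simp
      qed
      then show "\<omega> \<notin> (\<Inter>n. B n)" by blast
    qed
  qed
  moreover have "(\<Inter>n. B n) \<in> events" using B by auto
  ultimately have "prob (\<Inter>n. B n) = 0"
    using prob_eq_0 by blast
  with lim have "(\<lambda>n. prob (B n)) \<longlonglongrightarrow> 0" by simp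
  from order_tendstoD(2)[OF this \<open>0 < p\<close>] obtain n where "prob (B n) < p"
    using eventually_happens'[OF sequentially_bot] by blast
  then show ?thesis
    unfolding B_def by (intro exI[of _ "1 / real (Suc n)"]) auto
qed

text \<open>A Lebesgue number of \<open>[0, T]\<close> puts each short interval into one of the
  neighbourhoods just found, and oscillation events are monotone in the interval.\<close>

lemma prob_osc_uniformly_small:
  assumes "0 < K" "0 < p"
  shows "\<exists>H>0. \<forall>a b. 0 \<le> a \<longrightarrow> a \<le> b \<longrightarrow> b \<le> T \<longrightarrow> b - a < H \<longrightarrow> prob (osc_event a b K) \<le> p"
proof -
  define Q where "Q t \<delta> \<longleftrightarrow> prob (osc_event (max 0 (t - \<delta>)) (t + \<delta>) K) \<le> p" for t \<delta>
  have "\<exists>\<delta>>0. Q t \<delta>" if "0 \<le> t" "t \<le> T" for t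
    unfolding Q_def using prob_osc_locally_small[OF that(1) assms] .
  then have "\<exists>h>0. \<forall>s\<in>{0..T}. \<exists>t\<in>{0..T}. \<exists>\<delta>>0. Q t \<delta> \<and> ball s h \<subseteq> ball t \<delta>"
    by (rule lebesgue_number_Icc)
  then obtain h where h: "h > 0"
    "\<And>s. s \<in> {0..T} \<Longrightarrow> \<exists>t\<in>{0..T}. \<exists>\<delta>>0. Q t \<delta> \<and> ball s h \<subseteq> ball t \<delta>"
    by blast
  have "prob (osc_event a b K) \<le> p" if ab: "0 \<le> a" "a \<le> b" "b \<le> T" "b - a < h" for a b
  proof -
    have "a \<in> {0..T}" using ab by simp
    from h(2)[OF this] obtain t \<delta> where t: "0 \<le> t" "0 < \<delta>" "Q t \<delta>" and sub: "ball a h \<subseteq> ball t \<delta>" by auto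
    have "a \<in> ball a h" "b \<in> ball a h"
      using ab h by (simp_all add: dist_real_def)
    with sub have "a \<in> ball t \<delta>" "b \<in> ball t \<delta>" by blast+
    then have "\<bar>t - a\<bar> < \<delta>" "\<bar>t - b\<bar> < \<delta>" by (simp_all add: dist_real_def)
    then have "max 0 (t - \<delta>) \<le> a" "b \<le> t + \<delta>" using ab by linarith+
    then have "prob (osc_event a b K) \<le> prob (osc_event (max 0 (t - \<delta>)) (t + \<delta>) K)"
      using t by (intro finite_measure_mono osc_event_mono osc_event_events) auto
    with t show ?thesis unfolding Q_def by linarith
  qed
  with h(1) show ?thesis by blast
qed

lemma nn_integral_sup_exp_near_1:
  assumes "0 \<le> \<alpha>" "0 < \<epsilon>"
  shows "\<exists>H>0. \<forall>a b. 0 \<le> a \<longrightarrow> a \<le> b \<longrightarrow> b \<le> T \<longrightarrow> b - a < H \<longrightarrow>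
    (\<integral>\<^sup>+\<omega>. sup_exp \<alpha> a b \<omega> \<partial>M) \<le> ennreal (1 + \<epsilon>)"
proof -
  \<comment> \<open>\<open>\<eta> \<le> 1\<close> gives
    \<open>(1 + \<eta>)^2 \<le> 1 + 3 * \<eta> \<le> 1 + \<epsilon>\<close>.\<close>
  define \<eta> where "\<eta> = min 1 (\<epsilon> / 3)"
  have \<eta>: "0 < \<eta>" "\<eta> \<le> 1" "3 * \<eta> \<le> \<epsilon>" using assms by (auto simp: \<eta>_def)
  \<comment> \<open>The denominator has \<open>\<alpha> + 1\<close> to admit
    \<open>\<alpha> = 0\<close>. \<open>K\<close> is fixed before \<open>p\<close> because
    \<open>q\<close> depends on \<open>K\<close>.\<close>
  define K where "K = ln (1 + \<eta>) / (2 * (\<alpha> + 1))"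
  have "0 < K" using \<eta> assms by (simp add: K_def)
  have "2 * \<alpha> * K \<le> ln (1 + \<eta>)"
    using \<eta> assms by (simp add: K_def field_simps)
  then have eK: "exp (2 * \<alpha> * K) \<le> 1 + \<eta>"
    using \<eta> by (metis add_pos_pos exp_le_cancel_iff exp_ln zero_less_one)
  define q where "q = exp (2 * \<alpha> * (K + C + 1))"
  \<comment> \<open>Chosen so that \<open>1 / (1 - p * q) = 1 + \<eta>\<close>.\<close>
  define p where "p = \<eta> / ((1 + \<eta>) * q)"
  have "0 < q" by (simp add: q_def)
  then have p: "0 < p" "p * q = \<eta> / (1 + \<eta>)" using \<eta> by (simp_all add: p_def)
  have pq: "p * q < 1" "1 - p * q = 1 / (1 + \<eta>)" unfolding p(2) using \<eta> by (simp_all add: field_simps)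
  from prob_osc_uniformly_small[OF \<open>0 < K\<close> p(1), of T] obtain H where "H > 0" and
    H: "\<And>a b. 0 \<le> a \<Longrightarrow> a \<le> b \<Longrightarrow> b \<le> T \<Longrightarrow> b - a < H \<Longrightarrow> prob (osc_event a b K) \<le> p" by blast
  have "(\<integral>\<^sup>+\<omega>. sup_exp \<alpha> a b \<omega> \<partial>M) \<le> ennreal (1 + \<epsilon>)"
    if "0 \<le> a" "a \<le> b" "b \<le> T" "b - a < H" for a b
  proof -
    have "(\<integral>\<^sup>+\<omega>. sup_exp \<alpha> a b \<omega> \<partial>M) \<le> ennreal (exp (2 * \<alpha> * K) / (1 - p * q))"
      unfolding q_def using that assms \<open>0 < K\<close> H[OF that] pq(1)[unfolded q_def]
      by (intro nn_integral_sup_exp_le) auto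
    also have "exp (2 * \<alpha> * K) / (1 - p * q) = exp (2 * \<alpha> * K) * (1 + \<eta>)"
      unfolding pq(2) by simp
    also have "ennreal (exp (2 * \<alpha> * K) * (1 + \<eta>)) \<le> ennreal (1 + \<epsilon>)"
    proof (rule ennreal_leI)
      have "exp (2 * \<alpha> * K) * (1 + \<eta>) \<le> (1 + \<eta>) * (1 + \<eta>)"
        using eK \<eta> by (intro mult_right_mono) auto
      also have "\<dots> = 1 + 2 * \<eta> + \<eta> * \<eta>" by (simp add: algebra_simps)
      also have "\<dots> \<le> 1 + 3 * \<eta>" using \<eta> mult_left_mono[of \<eta> 1 \<eta>] by simp
      finally show "exp (2 * \<alpha> * K) * (1 + \<eta>) \<le> 1 + \<epsilon>" using \<eta> by linarith
    qed
    finally show ?thesis .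
  qed
  with \<open>H > 0\<close> show ?thesis by blast
qed

lemma nn_integral_sup_exp_minus_1:
  assumes "0 < \<epsilon>"
  shows "\<exists>H>0. \<forall>a b. 0 \<le> a \<longrightarrow> a \<le> b \<longrightarrow> b \<le> T \<longrightarrow> b - a < H \<longrightarrow>
    (\<integral>\<^sup>+\<omega>. (sup_exp \<alpha> a b \<omega> - 1) \<partial>M) < ennreal \<epsilon>"
proof -
  \<comment> \<open>\<open>\<epsilon> / 2\<close> leaves room for the strict inequality.\<close>
  from nn_integral_sup_exp_near_1[of "\<bar>\<alpha>\<bar>" "\<epsilon> / 2" T] assms obtain H where "H > 0" and
    H: "\<And>a b. 0 \<le> a \<Longrightarrow> a \<le> b \<Longrightarrow> b \<le> T \<Longrightarrow> b - a < H \<Longrightarrow>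
      (\<integral>\<^sup>+\<omega>. sup_exp \<bar>\<alpha>\<bar> a b \<omega> \<partial>M) \<le> ennreal (1 + \<epsilon> / 2)" by auto
  have "(\<integral>\<^sup>+\<omega>. (sup_exp \<alpha> a b \<omega> - 1) \<partial>M) < ennreal \<epsilon>"
    if ab: "0 \<le> a" "a \<le> b" "b \<le> T" "b - a < H" for a b
  proof -
    have "(\<integral>\<^sup>+\<omega>. (sup_exp \<alpha> a b \<omega> - 1) \<partial>M) \<le> (\<integral>\<^sup>+\<omega>. (sup_exp \<bar>\<alpha>\<bar> a b \<omega> - 1) \<partial>M)"
      by (intro nn_integral_mono ennreal_minus_mono sup_exp_le_abs order.refl)
    also have "\<dots> = (\<integral>\<^sup>+\<omega>. sup_exp \<bar>\<alpha>\<bar> a b \<omega> \<partial>M) - (\<integral>\<^sup>+\<omega>. 1 \<partial>M)"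
      using ab by (intro nn_integral_diff sup_exp_measurable) (auto simp: emeasure_space_1 sup_exp_ge_1)
    also have "\<dots> \<le> ennreal (1 + \<epsilon> / 2) - 1"
      using H[OF ab] by (auto simp: emeasure_space_1 intro!: ennreal_minus_mono)
    also have "\<dots> = ennreal (\<epsilon> / 2)"
      using ennreal_minus[of 1 "1 + \<epsilon> / 2"] by simp
    also have "\<dots> < ennreal \<epsilon>"
      using assms by (intro ennreal_lessI) auto
    finally show ?thesis .
  qed
  with \<open>H > 0\<close> show ?thesis by blast
qed

subsection \<open>Arbitrary time intervals\<close>

text \<open>The filtration provides independent sigma-algebras; those generated by \<open>f\<close>
  and \<open>g\<close> are contained in \<open>F s t\<close> and \<open>F t u\<close>.\<close>

lemma nn_integral_mult_indep:
  assumes s: "0 \<le> s" "s \<le> t" "t \<le> u"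
    and f: "f \<in> borel_measurable (F s t)" and g: "g \<in> borel_measurable (F t u)"
  shows "(\<integral>\<^sup>+\<omega>. f \<omega> * g \<omega> \<partial>M) = (\<integral>\<^sup>+\<omega>. f \<omega> \<partial>M) * (\<integral>\<^sup>+\<omega>. (g \<omega> :: ennreal) \<partial>M)"
proof -
  have fM [measurable]: "f \<in> borel_measurable M"
    by (rule measurable_from_subalg[OF F_subalgebra f]) (use s in auto)
  have gM [measurable]: "g \<in> borel_measurable M"
    by (rule measurable_from_subalg[OF F_subalgebra g]) (use s in auto)
  have "indep_var borel f borel g"
    unfolding indep_var_eq
  proof (intro conjI fM gM)
    have "sigma_sets (space M) {f -` A \<inter> space M |A. A \<in> sets borel} \<subseteq> sets (F s t)"
      using sets.sigma_sets_subset[of "{f -` A \<inter> space M |A. A \<in> sets borel}" "F s t"]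
        measurable_sets[OF f] s by auto
    moreover have "sigma_sets (space M) {g -` A \<inter> space M |A. A \<in> sets borel} \<subseteq> sets (F t u)"
      using sets.sigma_sets_subset[of "{g -` A \<inter> space M |A. A \<in> sets borel}" "F t u"]
        measurable_sets[OF g] s by auto
    ultimately show "indep_set (sigma_sets (space M) {f -` A \<inter> space M |A. A \<in> sets borel})
        (sigma_sets (space M) {g -` A \<inter> space M |A. A \<in> sets borel})"
      using indep_F[OF s] unfolding indep_set_def
      by (elim indep_sets_mono_sets) (auto split: bool.split)
  qed
  then have "indep_vars (case_bool borel borel) (case_bool f g) UNIV"
    by (simp add: indep_var_def)
  moreover have "case_bool borel borel = (\<lambda>_. borel :: ennreal measure)"
    by (simp add: fun_eq_iff split: bool.split)
  ultimately have "indep_vars (\<lambda>_. borel) (case_bool f g) UNIV" by simp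
  from indep_vars_nn_integral[OF _ this] show ?thesis
    by (simp add: UNIV_bool mult.commute)
qed

text \<open>A pair of times separated by \<open>b\<close> splits by the triangle inequality; for a
  pair on one side of \<open>b\<close> the other factor is at least 1.\<close>

lemma sup_exp_split:
  assumes "0 \<le> \<alpha>" "a \<le> b" "b \<le> c"
  shows "sup_exp \<alpha> a c \<omega> \<le> sup_exp \<alpha> a b \<omega> * sup_exp \<alpha> b c \<omega>"
proof -
  have up: "ennreal (exp (\<alpha> * d (y s \<omega>) (y t \<omega>))) \<le> sup_exp \<alpha> r u \<omega>"
    if "r \<le> s" "s \<le> t" "t \<le> u" for r s t u
    unfolding sup_exp_dist_def using that by (intro SUP_upper2[of "(s, t)"]) auto
  have "ennreal (exp (\<alpha> * d (y s \<omega>) (y t \<omega>))) \<le> sup_exp \<alpha> a b \<omega> * sup_exp \<alpha> b c \<omega>"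
    if st: "a \<le> s" "s \<le> t" "t \<le> c" for s t
  proof -
    consider "t \<le> b" | "b \<le> s" | "s < b" "b < t" by linarith
    then show ?thesis
    proof cases
      case 1
      then show ?thesis
        using mult_mono[OF up[OF st(1,2) 1] sup_exp_ge_1[OF assms(3), of \<alpha> \<omega>]] by simp
    next
      case 2
      then show ?thesis
        using mult_mono[OF sup_exp_ge_1[OF assms(2), of \<alpha> \<omega>] up[OF 2 st(2,3)]] by simp
    next
      case 3
      have "exp (\<alpha> * d (y s \<omega>) (y t \<omega>)) \<le> exp (\<alpha> * (d (y s \<omega>) (y b \<omega>) + d (y b \<omega>) (y t \<omega>)))"
        using assms d_triangle[of "y s \<omega>" "y t \<omega>" "y b \<omega>"] by (simp add: mult_left_mono)
      then have "ennreal (exp (\<alpha> * d (y s \<omega>) (y t \<omega>))) \<le>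
          ennreal (exp (\<alpha> * d (y s \<omega>) (y b \<omega>))) * ennreal (exp (\<alpha> * d (y b \<omega>) (y t \<omega>)))"
        by (simp add: ennreal_mult[symmetric] exp_add[symmetric] distrib_left ennreal_leI)
      also have "\<dots> \<le> sup_exp \<alpha> a b \<omega> * sup_exp \<alpha> b c \<omega>"
        using 3 st by (intro mult_mono up) auto
      finally show ?thesis .
    qed
  qed
  then show ?thesis
    unfolding sup_exp_dist_def[of d \<alpha> _ a c] by (intro SUP_least) auto
qed

lemma nn_integral_sup_exp_finite:
  assumes "0 \<le> r" "r \<le> u"
  shows "(\<integral>\<^sup>+\<omega>. sup_exp \<alpha> r u \<omega> \<partial>M) < \<infinity>"
proof -
  obtain H where "H > 0" and
    H: "\<And>a b. 0 \<le> a \<Longrightarrow> a \<le> b \<Longrightarrow> b \<le> u \<Longrightarrow> b - a < H \<Longrightarrow>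
      (\<integral>\<^sup>+\<omega>. sup_exp \<bar>\<alpha>\<bar> a b \<omega> \<partial>M) \<le> ennreal (1 + 1)"
    using nn_integral_sup_exp_near_1[of "\<bar>\<alpha>\<bar>" 1 u] by auto
  \<comment> \<open>Pieces of length \<open>H / 2\<close> are split off at the right end, so that
    each is strictly shorter than \<open>H\<close>. The strict bound on \<open>b - r\<close> makes
    the case \<open>n = 0\<close> void.\<close>
  have fin: "(\<integral>\<^sup>+\<omega>. sup_exp \<bar>\<alpha>\<bar> r b \<omega> \<partial>M) < \<infinity>" if "r \<le> b" "b \<le> u" "b - r < real n * (H / 2)" for n b
    using that
  proof (induction n arbitrary: b)
    case 0 then show ?case by simp
  next
    case (Suc n)
    define m where "m = max r (b - H / 2)"
    have m: "r \<le> m" "m \<le> b" "b - m < H" using Suc.prems \<open>H > 0\<close> by (auto simp: m_def)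
    have small: "(\<integral>\<^sup>+\<omega>. sup_exp \<bar>\<alpha>\<bar> m b \<omega> \<partial>M) < \<infinity>"
      using H[of m b] m assms Suc.prems by (auto simp: less_top[symmetric] top_unique)
    have first: "(\<integral>\<^sup>+\<omega>. sup_exp \<bar>\<alpha>\<bar> r m \<omega> \<partial>M) < \<infinity>"
    \<comment> \<open>The induction hypothesis with \<open>n = 0\<close> excludes even an interval
      of length 0, so that one is treated directly.\<close>
    proof (cases "m = r")
      case True
      then show ?thesis using H[of r m] assms \<open>H > 0\<close> by (auto simp: less_top[symmetric] top_unique)
    next
      case False
      then show ?thesis
        using Suc.prems m by (intro Suc.IH) (auto simp: m_def max_def field_simps split: if_splits)
    qed
    have "(\<integral>\<^sup>+\<omega>. sup_exp \<bar>\<alpha>\<bar> r b \<omega> \<partial>M) \<le> (\<integral>\<^sup>+\<omega>. sup_exp \<bar>\<alpha>\<bar> r m \<omega> * sup_exp \<bar>\<alpha>\<bar> m b \<omega> \<partial>M)"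
      using m by (intro nn_integral_mono sup_exp_split) auto
    also have "\<dots> = (\<integral>\<^sup>+\<omega>. sup_exp \<bar>\<alpha>\<bar> r m \<omega> \<partial>M) * (\<integral>\<^sup>+\<omega>. sup_exp \<bar>\<alpha>\<bar> m b \<omega> \<partial>M)"
      using assms m by (intro nn_integral_mult_indep[of r m b] sup_exp_measurable_F) auto
    also have "\<dots> < \<infinity>"
      using small first by (simp add: ennreal_mult_less_top)
    finally show ?case .
  qed
  obtain n where "u - r < real n * (H / 2)"
    using reals_Archimedean3[of "H / 2"] \<open>H > 0\<close> by fastforce
  with fin[of u n] assms have "(\<integral>\<^sup>+\<omega>. sup_exp \<bar>\<alpha>\<bar> r u \<omega> \<partial>M) < \<infinity>" by simp
  moreover have "(\<integral>\<^sup>+\<omega>. sup_exp \<alpha> r u \<omega> \<partial>M) \<le> (\<integral>\<^sup>+\<omega>. sup_exp \<bar>\<alpha>\<bar> r u \<omega> \<partial>M)"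
    by (intro nn_integral_mono sup_exp_le_abs)
  ultimately show ?thesis by (rule le_less_trans[rotated])
qed

end

section \<open>Left-invariant metrics\<close>

text \<open>\<open>'g\<close> keeps its own topology, in which the conditions on the process are
  stated; \<open>mtopology_eq\<close> ties the explicit metric \<open>d\<close> to it.\<close>

locale left_invariant_metric = group G + dist: Metric_space UNIV d
  for G :: "('g::t2_space) monoid" (structure) and d :: "'g \<Rightarrow> 'g \<Rightarrow> real" +
  assumes carrier_UNIV: "carrier G = UNIV"
    and mtopology_eq: "Metric_space.mtopology UNIV d = euclidean"
    and left_invariant: "d (g \<otimes> h) (g \<otimes> k) = d h k"
begin

lemma tendsto_iff_d: "(f \<longlongrightarrow> l) H \<longleftrightarrow> ((\<lambda>z. d (f z) l) \<longlongrightarrow> 0) H"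
proof -
  have "(f \<longlongrightarrow> l) H \<longleftrightarrow> limitin dist.mtopology f l H"
    by (simp add: mtopology_eq)
  then show ?thesis
    by (simp add: dist.limitin_metric tendsto_iff dist_real_def)
qed

lemma d_tri: "d g k \<le> d g h + d h k"
  by (rule dist.triangle) auto

lemma tendsto_d:
  assumes "(f \<longlongrightarrow> a) H" "(g \<longlongrightarrow> b) H"
  shows "((\<lambda>z. d (f z) (g z)) \<longlongrightarrow> d a b) H"
proof -
  have "\<bar>d (f z) (g z) - d a b\<bar> \<le> d (f z) a + d (g z) b" for z
    using d_tri[of "f z" "g z" a] d_tri[of a "g z" b] d_tri[of a b "f z"] d_tri[of "f z" b "g z"]
      dist.commute[of a "f z"] dist.commute[of b "g z"] by linarith
  then have bound: "eventually (\<lambda>z. norm (d (f z) (g z) - d a b) \<le> d (f z) a + d (g z) b) H"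
    by (intro always_eventually allI) (simp only: real_norm_def)
  have "((\<lambda>z. d (f z) a + d (g z) b) \<longlongrightarrow> 0) H"
    using tendsto_add[OF assms[unfolded tendsto_iff_d]] by simp
  with bound have "((\<lambda>z. d (f z) (g z) - d a b) \<longlongrightarrow> 0) H"
    by (rule Lim_null_comparison)
  then show ?thesis by (simp add: LIM_zero_iff)
qed

section \<open>The length function of a left-invariant metric\<close>

abbreviation len :: "'g \<Rightarrow> real" where
  "len g \<equiv> d \<one> g"

lemma continuous_len: "continuous_on UNIV len"
  unfolding continuous_on_def by (intro ballI tendsto_d tendsto_const tendsto_ident_at)

lemma d_mult_right: "d g (g \<otimes> h) = len h"
  using left_invariant[of g \<one> h] by (simp add: carrier_UNIV)

lemma len_mult_le: "len (g \<otimes> h) \<le> len g + len h"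
  using d_tri[of \<one> "g \<otimes> h" g] by (simp add: d_mult_right)

lemma len_set_power_le:
  assumes "\<And>g. g \<in> S \<Longrightarrow> len g \<le> c" "h \<in> set_power G S n"
  shows "len h \<le> real n * c"
  using assms(2)
proof (induction n arbitrary: h)
  case (Suc n)
  then obtain g k where gk: "g \<in> S" "k \<in> set_power G S n" "h = g \<otimes> k"
    by (auto simp: set_mult_def)
  have "len h \<le> len g + len k" unfolding gk(3) by (rule len_mult_le)
  also have "\<dots> \<le> c + real n * c" using assms(1)[OF gk(1)] Suc.IH[OF gk(2)] by linarith
  finally show ?case by (simp add: algebra_simps)
qed simp

text \<open>
  \<open>E X\<close> is the \<open>k\<close>-th power of \<open>E (X / k)\<close>, and \<open>E (X / k)\<close> is close to the identity
  for large \<open>k\<close>, uniformly in the ball.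
\<close>

lemma len_exponential_bounded:
  fixes E :: "'a::real_normed_vector \<Rightarrow> 'g"
  assumes add: "\<And>X s t. E ((s + t) *\<^sub>R X) = E (s *\<^sub>R X) \<otimes> E (t *\<^sub>R X)"
    and cont: "continuous_on V E" "open V" "0 \<in> V"
  obtains c where "\<And>X. X \<in> ball 0 \<delta> \<Longrightarrow> len (E X) \<le> c"
proof -
  have "E 0 = E 0 \<otimes> E 0" using add[of 0 0] by simp
  then have E0: "E 0 = \<one>" by (metis UNIV_I carrier_UNIV r_cancel_one')
  have multiple: "len (E (real n *\<^sub>R X)) \<le> real n * len (E X)" for n X
  proof (induction n)
    case (Suc n)
    have "len (E (real (Suc n) *\<^sub>R X)) \<le> len (E (real n *\<^sub>R X)) + len (E X)"
      using add[of "real n" 1 X] len_mult_le[of "E (real n *\<^sub>R X)" "E X"] by (simp add: add.commute)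
    then show ?case using Suc by (simp add: algebra_simps)
  qed (simp add: E0)
  \<comment> \<open>Continuity enters at 0 only. It gives a radius \<open>\<eta>\<close> within
    which lengths are at most 1, and the ball of radius \<open>\<delta>\<close> is reached from
    there by multiples.\<close>
  have "(E \<longlongrightarrow> E 0) (at 0)"
    using cont by (simp add: continuous_on_eq_continuous_at isCont_def)
  then have "((\<lambda>X. d (E X) \<one>) \<longlongrightarrow> 0) (at 0)"
    by (simp add: tendsto_iff_d E0)
  then have "eventually (\<lambda>X. d (E X) \<one> < 1) (at 0)"
    by (rule order_tendstoD) simp
  then obtain \<eta> where \<eta>: "\<eta> > 0" "\<And>X. X \<noteq> 0 \<Longrightarrow> norm X < \<eta> \<Longrightarrow> d (E X) \<one> < 1"
    unfolding eventually_at by (auto simp: dist_norm)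
  have near: "len (E X) \<le> 1" if "norm X < \<eta>" for X
    using \<eta>(2)[of X] that E0 by (cases "X = 0") (auto simp: dist.commute)
  obtain k where k: "\<bar>\<delta>\<bar> / \<eta> < real (Suc k)"
    using reals_Archimedean2[of "\<bar>\<delta>\<bar> / \<eta>"] by (metis less_Suc_eq less_trans of_nat_less_iff)
  have "len (E X) \<le> real (Suc k)" if "X \<in> ball 0 \<delta>" for X
  proof -
    have "norm X < real (Suc k) * \<eta>"
      using that k \<eta>(1) by (simp add: field_simps del: of_nat_Suc)
    then have "norm ((1 / real (Suc k)) *\<^sub>R X) < \<eta>"
      by (simp add: field_simps del: of_nat_Suc)
    from near[OF this] multiple[of "Suc k" "(1 / real (Suc k)) *\<^sub>R X"] show ?thesis
      by (simp del: of_nat_Suc) (smt (verit) mult_left_le of_nat_0_le_iff)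
  qed
  then show thesis using that by blast
qed

subsection \<open>Limits of two-parameter cadlag functions\<close>

lemma cadlag2_right:
  fixes z :: "real \<Rightarrow> real \<Rightarrow> 'g"
  assumes "cadlag2 z" "0 \<le> s" "s \<le> t"
  shows "((\<lambda>(s', t'). z s' t') \<longlongrightarrow> z s t) (at (s, t) within ({s..} \<times> {t..}) \<inter> two_param_domain)"
proof -
  have "(s, t) \<in> two_param_domain" using assms by (simp add: two_param_domain_def)
  with assms(1) show ?thesis unfolding cadlag2_def by blast
qed

lemma cadlag2_quadrant:
  fixes z :: "real \<Rightarrow> real \<Rightarrow> 'g"
  assumes "cadlag2 z" "0 \<le> s" "s \<le> t" "I \<in> {{..<s}, {s<..}}" "J \<in> {{..<t}, {t<..}}"
  obtains l where "((\<lambda>(s', t'). z s' t') \<longlongrightarrow> l) (at (s, t) within (I \<times> J) \<inter> two_param_domain)"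
proof -
  have "(s, t) \<in> two_param_domain" using assms by (simp add: two_param_domain_def)
  with assms that show thesis unfolding cadlag2_def by blast
qed

text \<open>Shifting both times by the same \<open>h\<close> preserves their order, even for
  \<open>s = t\<close>, so this approach to \<open>(s, t)\<close> never leaves the domain.\<close>

lemma cadlag2_diagonal:
  fixes z :: "real \<Rightarrow> real \<Rightarrow> 'g"
  assumes z: "cadlag2 z" and st: "0 \<le> s" "s \<le> t"
  shows "((\<lambda>h. z (s + h) (t + h)) \<longlongrightarrow> z s t) (at_right 0)"
proof -
  have "((\<lambda>h. (s + h, t + h)) \<longlongrightarrow> (s + 0, t + 0)) (at_right 0)"
    by (intro tendsto_intros)
  moreover have "eventually (\<lambda>h::real. 0 < h) (at_right 0)"
    by (rule eventually_at_right_less)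
  then have "eventually (\<lambda>h. (s + h, t + h) \<in> ({s..} \<times> {t..}) \<inter> two_param_domain \<and> (s + h, t + h) \<noteq> (s, t)) (at_right 0)"
    by eventually_elim (use st in \<open>auto simp: two_param_domain_def\<close>)
  ultimately have "filterlim (\<lambda>h. (s + h, t + h)) (at (s, t) within ({s..} \<times> {t..}) \<inter> two_param_domain) (at_right 0)"
    by (simp add: filterlim_at)
  from filterlim_compose[OF cadlag2_right[OF z st] this] show ?thesis by simp
qed

text \<open>
  By right-continuity along the diagonal, a boundary value is itself a limit of values inside the
  quadrant.
\<close>

lemma cadlag2_boundary_limit:
  fixes z :: "real \<Rightarrow> real \<Rightarrow> 'g"
  assumes z: "cadlag2 z"
    and lim: "((\<lambda>(s', t'). z s' t') \<longlongrightarrow> l) (at p within S \<inter> two_param_domain)"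
    and g: "(g \<longlongrightarrow> p) H" "eventually (\<lambda>x. g x \<in> two_param_domain) H"
    and near: "eventually (\<lambda>x. eventually (\<lambda>h. g x + (h, h) \<in> S - {p}) (at_right 0)) H"
  shows "((\<lambda>x. z (fst (g x)) (snd (g x))) \<longlongrightarrow> l) H"
  unfolding tendsto_iff_d
proof (rule order_tendstoI)
  fix e :: real assume "e < 0"
  then show "eventually (\<lambda>x. e < d (z (fst (g x)) (snd (g x))) l) H"
    by (intro always_eventually allI) (meson dist.nonneg less_le_trans)
next
  fix e :: real assume "0 < e"
  \<comment> \<open>Half of \<open>e\<close> is held back because the limit in the shift
    \<open>h\<close> turns the strict inequality into a weak one.\<close>
  then have "eventually (\<lambda>q. d (case q of (s', t') \<Rightarrow> z s' t') l < e / 2) (at p within S \<inter> two_param_domain)"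
    using order_tendstoD(2)[OF lim[unfolded tendsto_iff_d], of "e / 2"] by simp
  then obtain \<delta> where \<delta>: "\<delta> > 0" "\<And>q. q \<in> S \<Longrightarrow> q \<in> two_param_domain \<Longrightarrow> q \<noteq> p \<Longrightarrow> dist q p < \<delta> \<Longrightarrow>
      d (z (fst q) (snd q)) l < e / 2"
    unfolding eventually_at by (auto simp: case_prod_unfold)
  have "eventually (\<lambda>x. dist (g x) p < \<delta>) H"
    using g(1) \<delta>(1) by (rule tendstoD)
  with g(2) near show "eventually (\<lambda>x. d (z (fst (g x)) (snd (g x))) l < e) H"
  proof eventually_elim
    case (elim x)
    obtain s t where gx: "g x = (s, t)" by (cases "g x")
    with elim have st: "0 \<le> s" "s \<le> t" by (auto simp: two_param_domain_def)
    have "((\<lambda>h. dist (g x + (h, h)) p) \<longlongrightarrow> dist (g x + (0, 0)) p) (at_right 0)"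
      by (intro tendsto_intros)
    then have "eventually (\<lambda>h. dist (g x + (h, h)) p < \<delta>) (at_right 0)"
      using elim(3) by (intro order_tendstoD(2)) (auto simp: zero_prod_def[symmetric])
    moreover have "eventually (\<lambda>h::real. 0 < h) (at_right 0)"
      by (rule eventually_at_right_less)
    ultimately have "eventually (\<lambda>h. d (z (s + h) (t + h)) l \<le> e / 2) (at_right 0)"
      using elim(2)
    proof eventually_elim
      case (elim h)
      have "d (z (fst (s + h, t + h)) (snd (s + h, t + h))) l < e / 2"
        using elim st by (intro \<delta>(2)) (auto simp: gx two_param_domain_def)
      then show ?case by simp
    qed
    moreover have "((\<lambda>h. d (z (s + h) (t + h)) l) \<longlongrightarrow> d (z s t) l) (at_right 0)"
      by (intro tendsto_d cadlag2_diagonal[OF z st] tendsto_const)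
    ultimately have "d (z s t) l \<le> e / 2"
      by (intro tendsto_upperbound) auto
    then show ?case using \<open>0 < e\<close> gx by simp
  qed
qed

text \<open>The points \<open>(0, s)\<close> lie in no open quadrant at \<open>(0, t)\<close>: they
  are on the boundary of the one with first argument above 0. The shift \<open>(h, s + h)\<close>
  enters it for \<open>0 < h < t - s\<close>.\<close>

lemma cadlag2_left_limit_upper:
  fixes z :: "real \<Rightarrow> real \<Rightarrow> 'g"
  assumes z: "cadlag2 z" and "0 < t"
  shows "\<exists>l. ((\<lambda>s. z 0 s) \<longlongrightarrow> l) (at_left t)"
proof -
  obtain l where l: "((\<lambda>(s', t'). z s' t') \<longlongrightarrow> l) (at (0, t) within ({0<..} \<times> {..<t}) \<inter> two_param_domain)"
    using cadlag2_quadrant[OF z, of 0 t "{0<..}" "{..<t}"] assms by auto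
  have "((\<lambda>s. z (fst (0, s)) (snd (0::real, s))) \<longlongrightarrow> l) (at_left t)"
  proof (rule cadlag2_boundary_limit[OF z l])
    show "((\<lambda>s. (0, s)) \<longlongrightarrow> (0, t)) (at_left t)" by (intro tendsto_intros)
    have *: "eventually (\<lambda>s. s \<in> {0<..<t}) (at_left t)"
      using \<open>0 < t\<close> by (rule eventually_at_left_real)
    then show "eventually (\<lambda>s. (0, s) \<in> two_param_domain) (at_left t)"
      by eventually_elim (auto simp: two_param_domain_def)
    from * show "eventually (\<lambda>s. eventually (\<lambda>h. (0, s) + (h, h) \<in> {0<..} \<times> {..<t} - {(0, t)}) (at_right 0)) (at_left t)"
    proof eventually_elim
      case (elim s)
      then have "eventually (\<lambda>h. h \<in> {0<..<t - s}) (at_right 0)"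
        by (intro eventually_at_right_real) auto
      then show ?case by eventually_elim auto
    qed
  qed
  then show ?thesis by auto
qed

text \<open>Now the second argument stays at \<open>t\<close>. The quadrant at \<open>(t, t)\<close>
  with first argument below and second above \<open>t\<close> is entered by
  \<open>(s + h, t + h)\<close> for \<open>0 < h < t - s\<close>. The limit is the jump of the
  process at \<open>t\<close>.\<close>

lemma cadlag2_left_limit_lower:
  fixes z :: "real \<Rightarrow> real \<Rightarrow> 'g"
  assumes z: "cadlag2 z" and "0 < t"
  shows "\<exists>l. ((\<lambda>s. z s t) \<longlongrightarrow> l) (at_left t)"
proof -
  obtain l where l: "((\<lambda>(s', t'). z s' t') \<longlongrightarrow> l) (at (t, t) within ({..<t} \<times> {t<..}) \<inter> two_param_domain)"
    using cadlag2_quadrant[OF z, of t t "{..<t}" "{t<..}"] assms by auto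
  have "((\<lambda>s. z (fst (s, t)) (snd (s, t))) \<longlongrightarrow> l) (at_left t)"
  proof (rule cadlag2_boundary_limit[OF z l])
    show "((\<lambda>s. (s, t)) \<longlongrightarrow> (t, t)) (at_left t)" by (intro tendsto_intros)
    have *: "eventually (\<lambda>s. s \<in> {0<..<t}) (at_left t)"
      using \<open>0 < t\<close> by (rule eventually_at_left_real)
    then show "eventually (\<lambda>s. (s, t) \<in> two_param_domain) (at_left t)"
      by eventually_elim (auto simp: two_param_domain_def)
    from * show "eventually (\<lambda>s. eventually (\<lambda>h. (s, t) + (h, h) \<in> {..<t} \<times> {t<..} - {(t, t)}) (at_right 0)) (at_left t)"
    proof eventually_elim
      case (elim s)
      then have "eventually (\<lambda>h. h \<in> {0<..<t - s}) (at_right 0)"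
        by (intro eventually_at_right_real) auto
      then show ?case by eventually_elim auto
    qed
  qed
  then show ?thesis by auto
qed

lemma cadlag2_right_limit:
  fixes z :: "real \<Rightarrow> real \<Rightarrow> 'g"
  assumes z: "cadlag2 z" and "0 \<le> t"
  shows "((\<lambda>s. z 0 s) \<longlongrightarrow> z 0 t) (at_right t)"
proof -
  have "((\<lambda>s. (0::real, s)) \<longlongrightarrow> (0, t)) (at_right t)"
    by (intro tendsto_intros)
  moreover have "eventually (\<lambda>s. t < s) (at_right t)"
    by (rule eventually_at_right_less)
  then have "eventually (\<lambda>s. (0, s) \<in> ({0..} \<times> {t..}) \<inter> two_param_domain \<and> (0, s) \<noteq> (0, t)) (at_right t)"
    by eventually_elim (use assms in \<open>auto simp: two_param_domain_def\<close>)
  ultimately have "filterlim (\<lambda>s. (0, s)) (at (0, t) within ({0..} \<times> {t..}) \<inter> two_param_domain) (at_right t)"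
    by (simp add: filterlim_at)
  from filterlim_compose[OF cadlag2_right[OF z order.refl \<open>0 \<le> t\<close>] this] show ?thesis by simp
qed

text \<open>Rational times \<open>p n \<le> q n\<close> decrease to \<open>s\<close> and
  \<open>t\<close>, and both sides of the identity are limits along them: the left one by
  right-continuity of \<open>z 0\<close>, the right one by joint right-continuity of
  \<open>z\<close>.\<close>

lemma multiplicative_extend:
  fixes z :: "real \<Rightarrow> real \<Rightarrow> 'g"
  assumes z: "cadlag2 z"
    and mult: "\<And>s t. s \<in> \<rat> \<Longrightarrow> t \<in> \<rat> \<Longrightarrow> 0 \<le> s \<Longrightarrow> s \<le> t \<Longrightarrow> z 0 s \<otimes> z s t = z 0 t"
    and st: "0 \<le> s" "s \<le> t"
  shows "d (z 0 s) (z 0 t) = len (z s t)"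
proof -
  have "\<exists>p q. (\<forall>n. p n \<in> \<rat> \<and> q n \<in> \<rat> \<and> s < p n \<and> t < q n \<and> p n \<le> q n) \<and> p \<longlonglongrightarrow> s \<and> q \<longlonglongrightarrow> t"
  \<comment> \<open>If \<open>s = t\<close>, one sequence serves twice; otherwise
    \<open>p n < t < q n\<close> secures the order.\<close>
  proof (cases "s = t")
    case True
    have "t < t + 1" by simp
    from ex_rational_sequence_right[OF this] obtain q where
      "\<And>n. q n \<in> \<rat>" "\<And>n. t < q n" "q \<longlonglongrightarrow> t" by blast
    with True show ?thesis by (intro exI[of _ q] conjI allI) simp_all
  next
    case False
    with st have "s < t" by simp
    from ex_rational_sequence_right[OF this] obtain p where
      p: "\<And>n. p n \<in> \<rat>" "\<And>n. s < p n" "\<And>n. p n < t" "p \<longlonglongrightarrow> s" by blast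
    have "t < t + 1" by simp
    from ex_rational_sequence_right[OF this] obtain q where
      q: "\<And>n. q n \<in> \<rat>" "\<And>n. t < q n" "q \<longlonglongrightarrow> t" by blast
    have "p n \<le> q n" for n using p(3)[of n] q(2)[of n] by linarith
    with p q show ?thesis by (intro exI[of _ p] exI[of _ q] conjI allI)
  qed
  then obtain p q where pq: "\<And>n. p n \<in> \<rat>" "\<And>n. q n \<in> \<rat>" "\<And>n. s < p n" "\<And>n. t < q n" "\<And>n. p n \<le> q n"
    and lim: "p \<longlonglongrightarrow> s" "q \<longlonglongrightarrow> t" by blast
  have "0 \<le> t" using st by linarith
  have "0 \<le> p n" for n using pq(3)[of n] st by linarith
  then have eq: "d (z 0 (p n)) (z 0 (q n)) = len (z (p n) (q n))" for n
    using mult[OF pq(1,2), of n] pq(5)[of n] d_mult_right[of "z 0 (p n)" "z (p n) (q n)"] by simp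
  have "filterlim p (at_right s) sequentially" "filterlim q (at_right t) sequentially"
    using pq(3,4) lim by (simp_all add: filterlim_at less_imp_neq[symmetric])
  then have "(\<lambda>n. d (z 0 (p n)) (z 0 (q n))) \<longlonglongrightarrow> d (z 0 s) (z 0 t)"
    by (intro tendsto_d filterlim_compose[OF cadlag2_right_limit[OF z st(1)]]
          filterlim_compose[OF cadlag2_right_limit[OF z \<open>0 \<le> t\<close>]])
  moreover have "(\<lambda>n. len (z (p n) (q n))) \<longlonglongrightarrow> len (z s t)"
  proof (intro tendsto_d tendsto_const)
    have "(p n, q n) \<in> ({s..} \<times> {t..}) \<inter> two_param_domain \<and> (p n, q n) \<noteq> (s, t)" for n
      using pq(3-5)[of n] st by (auto simp: two_param_domain_def)
    moreover have "(\<lambda>n. (p n, q n)) \<longlonglongrightarrow> (s, t)" using lim by (intro tendsto_Pair)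
    ultimately have "filterlim (\<lambda>n. (p n, q n)) (at (s, t) within ({s..} \<times> {t..}) \<inter> two_param_domain) sequentially"
      by (simp add: filterlim_at)
    from filterlim_compose[OF cadlag2_right[OF z st] this]
    show "(\<lambda>n. z (p n) (q n)) \<longlonglongrightarrow> z s t" by simp
  qed
  ultimately show ?thesis
    unfolding eq by (rule LIMSEQ_unique)
qed

subsection \<open>Multiplicative processes\<close>

text \<open>Each pair of times has its own exceptional null set in the multiplicative relation.
  Rational pairs contribute only countably many of them, and right-continuity reaches all other
  pairs.\<close>

lemma AE_d_eq_len:
  assumes mult: "multiplicative_process G M F x"
    and cadlag: "\<forall>\<omega>\<in>space M. cadlag2 (\<lambda>s t. x s t \<omega>)"
  shows "AE \<omega> in M. \<forall>s t. 0 \<le> s \<longrightarrow> s \<le> t \<longrightarrow> d (x 0 s \<omega>) (x 0 t \<omega>) = len (x s t \<omega>)"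
proof -
  have "AE \<omega> in M. 0 \<le> s \<longrightarrow> s \<le> t \<longrightarrow> x 0 s \<omega> \<otimes> x s t \<omega> = x 0 t \<omega>" for s t
  proof (cases "0 \<le> s \<and> s \<le> t")
    case True
    then have "AE \<omega> in M. x 0 s \<omega> \<otimes> x s t \<omega> = x 0 t \<omega>"
      using mult order.refl[of "0::real"] unfolding multiplicative_process_def by simp
    then show ?thesis by eventually_elim simp
  next
    case False
    then show ?thesis by (intro AE_I2 impI) simp
  qed
  then have "AE \<omega> in M. \<forall>s\<in>\<rat>. \<forall>t\<in>\<rat>. 0 \<le> s \<longrightarrow> s \<le> t \<longrightarrow> x 0 s \<omega> \<otimes> x s t \<omega> = x 0 t \<omega>"
    by (simp only: AE_ball_countable[OF countable_rat] ball_simps simp_thms) simp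
  moreover have "AE \<omega> in M. cadlag2 (\<lambda>s t. x s t \<omega>)"
    using cadlag by (intro AE_I2) blast
  ultimately show ?thesis
  proof eventually_elim
    case (elim \<omega>)
    show ?case
    proof (intro allI impI)
      fix s t :: real assume st: "0 \<le> s" "s \<le> t"
      show "d (x 0 s \<omega>) (x 0 t \<omega>) = len (x s t \<omega>)"
        by (rule multiplicative_extend[where z = "\<lambda>s t. x s t \<omega>", OF elim(2) _ st])
          (rule elim(1)[rule_format])
    qed
  qed
qed

text \<open>Stochastic continuity at \<open>(t, t)\<close> makes the distance of
  \<open>x 0 s\<close> and \<open>x 0 t\<close> tend to 0 in probability as \<open>s\<close>
  increases to \<open>t\<close>. The left limit of the path exists anyway, so it must be the value
  at \<open>t\<close>.\<close>

lemma AE_no_fixed_jump: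
  assumes M: "prob_space M" "complete_measure M"
    and meas: "\<And>s t. 0 \<le> s \<Longrightarrow> s \<le> t \<Longrightarrow> (\<lambda>\<omega>. d (x 0 s \<omega>) (x 0 t \<omega>)) \<in> borel_measurable M"
    and mult: "multiplicative_process G M F x"
    and cadlag: "\<forall>\<omega>\<in>space M. cadlag2 (\<lambda>s t. x s t \<omega>)"
    and t: "0 < t"
  shows "AE \<omega> in M. ((\<lambda>s. d (x 0 s \<omega>) (x 0 t \<omega>)) \<longlongrightarrow> 0) (at_left t)"
proof -
  interpret prob_space M by fact
  interpret complete_measure M by fact
  define s where "s n = t - t / real (Suc (Suc n))" for n
  have s: "0 \<le> s n" "s n < t" for n using t by (simp_all add: s_def field_simps)
  have "(\<lambda>n. t / real (Suc (Suc n))) \<longlonglongrightarrow> 0"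
    by (intro tendsto_divide_0[OF tendsto_const] filterlim_at_top_imp_at_infinity
          filterlim_compose[OF filterlim_real_sequentially] filterlim_compose[OF filterlim_Suc filterlim_Suc])
  then have slim: "s \<longlonglongrightarrow> t" unfolding s_def using tendsto_diff[OF tendsto_const, of _ 0 sequentially t] by simp
  have s_left: "filterlim s (at_left t) sequentially"
    using slim s(2) by (simp add: filterlim_at less_imp_neq)
  have "AE \<omega> in M. \<not> eventually (\<lambda>n. \<omega> \<in> {\<omega> \<in> space M. \<eta> < d (x 0 (s n) \<omega>) (x 0 t \<omega>)}) sequentially"
    if "0 < \<eta>" for \<eta>
  proof (rule AE_not_eventually_of_prob_tendsto_0)
    have m: "(\<lambda>\<omega>. d (x 0 (s n) \<omega>) (x 0 t \<omega>)) \<in> borel_measurable M" for n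
      using s[of n] by (intro meas) auto
    show A: "{\<omega> \<in> space M. \<eta> < d (x 0 (s n) \<omega>) (x 0 t \<omega>)} \<in> events" for n
      by (intro borel_measurable_less borel_measurable_const m)
    define U where "U = {g. len g < \<eta>}"
    have "open U"
      unfolding U_def by (intro open_Collect_less continuous_len continuous_on_const)
    have "\<one> \<in> U" using that by (simp add: U_def)
    have lim: "((\<lambda>(h, k). prob {\<omega> \<in> space M. inv (x t t \<omega>) \<otimes> x (t + h) (t + k) \<omega> \<in> U})
        \<longlongrightarrow> 1) (at (0, 0) within {(h, k). (t + h, t + k) \<in> two_param_domain})"
    proof -
      have "\<forall>s t U. 0 \<le> s \<longrightarrow> s \<le> t \<longrightarrow> open U \<longrightarrow> \<one> \<in> U \<longrightarrow>
        ((\<lambda>(h, k). prob {\<omega> \<in> space M. inv (x s t \<omega>) \<otimes> x (s + h) (t + k) \<omega> \<in> U})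
           \<longlongrightarrow> 1) (at (0, 0) within {(h, k). (s + h, t + k) \<in> two_param_domain})"
        using mult unfolding multiplicative_process_def by (elim conjE)
      from this[rule_format, OF less_imp_le[OF t] order.refl] show ?thesis
        using \<open>open U\<close> \<open>\<one> \<in> U\<close> .
    qed
    \<comment> \<open>Only the first argument moves: \<open>h = s n - t\<close> and
      \<open>k = 0\<close>.\<close>
    have "(\<lambda>n. (s n - t, 0)) \<longlonglongrightarrow> (t - t, 0)"
      by (intro tendsto_intros slim)
    moreover have "(s n - t, 0) \<in> {(h, k). (t + h, t + k) \<in> two_param_domain} \<and> (s n - t, 0) \<noteq> (0::real, 0::real)" for n
      using s[of n] by (simp add: two_param_domain_def)
    ultimately have "filterlim (\<lambda>n. (s n - t, 0)) (at (0, 0) within {(h, k). (t + h, t + k) \<in> two_param_domain}) sequentially"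
      by (simp add: filterlim_at)
    from filterlim_compose[OF lim this]
    have lim': "(\<lambda>n. prob {\<omega> \<in> space M. inv (x t t \<omega>) \<otimes> x (s n) t \<omega> \<in> U}) \<longlonglongrightarrow> 1"
      by simp
    have "prob {\<omega> \<in> space M. \<eta> < d (x 0 (s n) \<omega>) (x 0 t \<omega>)} \<le>
        1 - prob {\<omega> \<in> space M. inv (x t t \<omega>) \<otimes> x (s n) t \<omega> \<in> U}" for n
    proof -
      let ?B = "{\<omega> \<in> space M. inv (x t t \<omega>) \<otimes> x (s n) t \<omega> \<in> U}"
      let ?C = "{\<omega> \<in> space M. d (x 0 (s n) \<omega>) (x 0 t \<omega>) < \<eta>}"
      let ?A = "{\<omega> \<in> space M. \<eta> < d (x 0 (s n) \<omega>) (x 0 t \<omega>)}"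
      have C: "?C \<in> events"
        by (intro borel_measurable_less borel_measurable_const m)
      have "AE \<omega> in M. x t t \<omega> = \<one>"
        using mult less_imp_le[OF t] unfolding multiplicative_process_def by simp
      with AE_d_eq_len[OF mult cadlag] have ae: "AE \<omega> in M. \<omega> \<in> ?C \<longleftrightarrow> \<omega> \<in> ?B"
      proof eventually_elim
        case (elim \<omega>)
        have "d (x 0 (s n) \<omega>) (x 0 t \<omega>) = len (x (s n) t \<omega>)"
          using elim(1)[rule_format, OF s(1) less_imp_le[OF s(2)]] .
        moreover have "inv (x t t \<omega>) \<otimes> x (s n) t \<omega> = x (s n) t \<omega>"
          using elim(2) by (simp add: carrier_UNIV)
        ultimately show ?case by (simp add: U_def)
      qed
      \<comment> \<open>\<open>?B\<close> involves a product in the group; it is an event because it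
        agrees almost surely with \<open>?C\<close> and \<open>M\<close> is complete.\<close>
      then have B: "?B \<in> events" using C by (rule in_sets_AE) auto
      have "prob ?A + prob ?C = prob (?A \<union> ?C)"
        using A C by (intro finite_measure_Union[symmetric]) auto
      also have "\<dots> \<le> 1" by simp
      finally show ?thesis using finite_measure_eq_AE[OF ae C B] by linarith
    qed
    note le = this
    have lim0: "(\<lambda>n. 1 - prob {\<omega> \<in> space M. inv (x t t \<omega>) \<otimes> x (s n) t \<omega> \<in> U}) \<longlonglongrightarrow> 0"
      using tendsto_diff[OF tendsto_const lim', of 1] by simp
    show "(\<lambda>n. prob {\<omega> \<in> space M. \<eta> < d (x 0 (s n) \<omega>) (x 0 t \<omega>)}) \<longlonglongrightarrow> 0"
      by (rule tendsto_sandwich[OF always_eventually always_eventually tendsto_const lim0])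
        (intro allI measure_nonneg le)+
  qed
  then have "AE \<omega> in M. \<forall>k. \<not> eventually (\<lambda>n. \<omega> \<in> {\<omega> \<in> space M. inverse (real (Suc k)) < d (x 0 (s n) \<omega>) (x 0 t \<omega>)}) sequentially"
    by (simp add: AE_all_countable)
  then show ?thesis
  proof (rule AE_mp, intro AE_I2 impI)
    fix \<omega> assume \<omega>: "\<omega> \<in> space M" and
      small: "\<forall>k. \<not> eventually (\<lambda>n. \<omega> \<in> {\<omega> \<in> space M. inverse (real (Suc k)) < d (x 0 (s n) \<omega>) (x 0 t \<omega>)}) sequentially"
    have "cadlag2 (\<lambda>s t. x s t \<omega>)" using cadlag \<omega> by blast
    from cadlag2_left_limit_upper[OF this t] obtain l where
      "((\<lambda>s. x 0 s \<omega>) \<longlongrightarrow> l) (at_left t)" by blast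
    then have dl: "((\<lambda>s. d (x 0 s \<omega>) (x 0 t \<omega>)) \<longlongrightarrow> d l (x 0 t \<omega>)) (at_left t)"
      by (intro tendsto_d tendsto_const)
    have "d l (x 0 t \<omega>) = 0"
    proof (rule ccontr)
      assume "d l (x 0 t \<omega>) \<noteq> 0"
      then have "0 < d l (x 0 t \<omega>)" using dist.nonneg[of l "x 0 t \<omega>"] by linarith
      then obtain k where k: "inverse (real (Suc k)) < d l (x 0 t \<omega>)"
        using reals_Archimedean by blast
      have "eventually (\<lambda>n. inverse (real (Suc k)) < d (x 0 (s n) \<omega>) (x 0 t \<omega>)) sequentially"
        using order_tendstoD(1)[OF filterlim_compose[OF dl s_left] k] .
      with small \<omega> show False by simp
    qed
    with dl show "((\<lambda>s. d (x 0 s \<omega>) (x 0 t \<omega>)) \<longlongrightarrow> 0) (at_left t)" by simp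
  qed
qed

text \<open>The hypothesis concerns the left limit \<open>m\<close> of \<open>x s t\<close> in
  \<open>s\<close>, the conclusion the left limit \<open>l\<close> of \<open>x 0 s\<close>. Letting
  \<open>s\<close> increase to \<open>t\<close> in the identity of \<open>AE_d_eq_len\<close> shows
  that \<open>len m\<close> is the distance from \<open>l\<close> to \<open>x 0 t\<close>.\<close>

lemma AE_jump_le:
  assumes mult: "multiplicative_process G M F x"
    and cadlag: "\<forall>\<omega>\<in>space M. cadlag2 (\<lambda>s t. x s t \<omega>)"
    and jump: "AE \<omega> in M. \<forall>t\<ge>0. len (jump_at G (\<lambda>s t. x s t \<omega>) t) \<le> C"
  shows "AE \<omega> in M. \<forall>t>0. \<forall>l. ((\<lambda>s. d (x 0 s \<omega>) l) \<longlongrightarrow> 0) (at_left t) \<longrightarrow> d l (x 0 t \<omega>) \<le> C"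
proof -
  have "AE \<omega> in M. cadlag2 (\<lambda>s t. x s t \<omega>)"
    using cadlag by (intro AE_I2) blast
  with AE_d_eq_len[OF mult cadlag] jump show ?thesis
  proof eventually_elim
    case (elim \<omega>)
    show ?case
    proof (intro allI impI)
      fix t :: real and l
      assume t: "0 < t" and "((\<lambda>s. d (x 0 s \<omega>) l) \<longlongrightarrow> 0) (at_left t)"
      then have "((\<lambda>s. x 0 s \<omega>) \<longlongrightarrow> l) (at_left t)" by (simp add: tendsto_iff_d)
      then have dl: "((\<lambda>s. d (x 0 s \<omega>) (x 0 t \<omega>)) \<longlongrightarrow> d l (x 0 t \<omega>)) (at_left t)"
        by (intro tendsto_d tendsto_const)
      from cadlag2_left_limit_lower[OF elim(3) t] obtain m where
        m: "((\<lambda>s. x s t \<omega>) \<longlongrightarrow> m) (at_left t)" by blast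
      then have jm: "jump_at G (\<lambda>s t. x s t \<omega>) t = m"
        using t by (simp add: jump_at_def tendsto_Lim)
      have "((\<lambda>s. len (x s t \<omega>)) \<longlongrightarrow> len m) (at_left t)"
        using m by (intro tendsto_d tendsto_const)
      moreover have "eventually (\<lambda>s. len (x s t \<omega>) = d (x 0 s \<omega>) (x 0 t \<omega>)) (at_left t)"
        using eventually_at_left_real[OF t]
      proof eventually_elim
        case (elim s)
        then have "0 \<le> s" "s \<le> t" by auto
        then show ?case using \<open>\<forall>s t. 0 \<le> s \<longrightarrow> s \<le> t \<longrightarrow> d (x 0 s \<omega>) (x 0 t \<omega>) = len (x s t \<omega>)\<close> by simp
      qed
      ultimately have "((\<lambda>s. d (x 0 s \<omega>) (x 0 t \<omega>)) \<longlongrightarrow> len m) (at_left t)"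
        by (rule Lim_transform_eventually)
      with dl have "d l (x 0 t \<omega>) = len m"
        by (intro tendsto_unique) auto
      also have "\<dots> \<le> C" using elim(2) t jm by (metis less_imp_le)
      finally show "d l (x 0 t \<omega>) \<le> C" .
    qed
  qed
qed

text \<open>The point is measurability. \<open>x 0 s\<close> and \<open>x 0 t\<close> depend on the
  whole past, but their distance is almost surely \<open>len (x s t \<omega>)\<close>, and
  \<open>F s t\<close> contains the null sets. Hence distances over \<open>[s, t]\<close> are
  independent of the events before \<open>s\<close>.\<close>

lemma metric_indep_increments_multiplicative_process:
  assumes M: "prob_space M" "complete_measure M"
    and filt: "additive_filtration M F" "usual_hypotheses M F"
    and mult: "multiplicative_process G M F x"
    and cadlag: "\<forall>\<omega>\<in>space M. cadlag2 (\<lambda>s t. x s t \<omega>)"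
    and C: "0 \<le> C"
    and jump: "AE \<omega> in M. \<forall>t\<ge>0. len (jump_at G (\<lambda>s t. x s t \<omega>) t) \<le> C"
  shows "metric_indep_increments M d F (x 0) C"
proof -
  have sub: "subalgebra M (F s t)" if "0 \<le> s" "s \<le> t" for s t
    using filt(1) that by (simp add: additive_filtration_def)
  have meas: "(\<lambda>\<omega>. d (x 0 s \<omega>) (x 0 t \<omega>)) \<in> borel_measurable (F s t)" if st: "0 \<le> s" "s \<le> t" for s t
  proof (rule borel_measurable_AE_cong_complete[OF M(2) sub[OF st]])
    show "null_sets M \<subseteq> sets (F s t)"
      using filt(2) st unfolding usual_hypotheses_def by blast
    have "x s t \<in> borel_measurable (F s t)"
      using mult st by (simp add: multiplicative_process_def)
    moreover have "len \<in> borel_measurable borel"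
      by (rule borel_measurable_continuous_onI[OF continuous_len])
    ultimately show "(\<lambda>\<omega>. len (x s t \<omega>)) \<in> borel_measurable (F s t)"
      by (rule measurable_compose)
    show "AE \<omega> in M. len (x s t \<omega>) = d (x 0 s \<omega>) (x 0 t \<omega>)"
      using AE_d_eq_len[OF mult cadlag] by eventually_elim (use st in simp)
  qed
  have measM: "(\<lambda>\<omega>. d (x 0 s \<omega>) (x 0 t \<omega>)) \<in> borel_measurable M" if "0 \<le> s" "s \<le> t" for s t
    by (rule measurable_from_subalg[OF sub meas]) (use that in auto)
  show ?thesis
  proof (intro metric_indep_increments.intro M(1) metric_indep_increments_axioms.intro dist.Metric_space_axioms)
    fix t :: real
    assume "0 < t"
    then show "AE \<omega> in M. ((\<lambda>s. d (x 0 s \<omega>) (x 0 t \<omega>)) \<longlongrightarrow> 0) (at_left t)"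
      by (intro AE_no_fixed_jump[OF M _ mult cadlag] measM)
  next
    fix \<omega> and t :: real
    assume "\<omega> \<in> space M" and t: "0 \<le> t"
    then have "cadlag2 (\<lambda>s t. x s t \<omega>)" using cadlag by blast
    from cadlag2_right_limit[OF this t]
    show "((\<lambda>s. d (x 0 s \<omega>) (x 0 t \<omega>)) \<longlongrightarrow> 0) (at_right t)"
      by (simp add: tendsto_iff_d)
  next
    fix \<omega> and t :: real
    assume "\<omega> \<in> space M" and t: "0 < t"
    then have "cadlag2 (\<lambda>s t. x s t \<omega>)" using cadlag by blast
    from cadlag2_left_limit_upper[OF this t]
    show "\<exists>l. ((\<lambda>s. d (x 0 s \<omega>) l) \<longlongrightarrow> 0) (at_left t)"
      by (simp add: tendsto_iff_d)
  qed (fact filt meas C AE_jump_le[OF mult cadlag jump])+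
qed

lemma bounded_jumps_len:
  assumes exp: "lie_exponential G A c E" and log: "log_domains G A E V W"
    and jumps: "bounded_jumps G E W M x"
  obtains C where "0 \<le> C" "AE \<omega> in M. \<forall>t\<ge>0. len (jump_at G (\<lambda>s t. x s t \<omega>) t) \<le> C"
proof -
  from jumps obtain \<delta> n where
    jump: "AE \<omega> in M. \<forall>t\<ge>0. jump_at G (\<lambda>s t. x s t \<omega>) t \<in> set_power G (E ` ball 0 \<delta>) n"
    unfolding bounded_jumps_def by blast
  have "E ((s + t) *\<^sub>R X) = E (s *\<^sub>R X) \<otimes> E (t *\<^sub>R X)" for X s t
    using exp unfolding lie_exponential_def one_parameter_subgroup_def by blast
  moreover have "continuous_on V E" "open V" "0 \<in> V"
    using log unfolding log_domains_def diffeomorphism_on_def smooth_map_on_def by blast+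
  ultimately obtain b where b: "\<And>X. X \<in> ball 0 \<delta> \<Longrightarrow> len (E X) \<le> b"
    using len_exponential_bounded by blast
  show thesis
  \<comment> \<open>A jump is a product of \<open>n\<close> factors of length at most
    \<open>b\<close>; \<open>max 0 b\<close> secures that the constant is nonnegative.\<close>
  proof (rule that[of "real n * max 0 b"])
    have "len g \<le> max 0 b" if "g \<in> E ` ball 0 \<delta>" for g
      using b that by (auto simp: le_max_iff_disj)
    note le = this
    show "AE \<omega> in M. \<forall>t\<ge>0. len (jump_at G (\<lambda>s t. x s t \<omega>) t) \<le> real n * max 0 b"
    proof (rule AE_mp[OF jump], intro AE_I2 impI allI)
      fix \<omega> and t :: real
      assume "\<forall>t\<ge>0. jump_at G (\<lambda>s t. x s t \<omega>) t \<in> set_power G (E ` ball 0 \<delta>) n" "0 \<le> t"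
      then have "jump_at G (\<lambda>s t. x s t \<omega>) t \<in> set_power G (E ` ball 0 \<delta>) n" by simp
      with le show "len (jump_at G (\<lambda>s t. x s t \<omega>) t) \<le> real n * max 0 b"
        by (rule len_set_power_le)
    qed
  qed simp
qed

end

theorem theorem4p3:
  fixes G :: "('g::t2_space) monoid" (structure)
    and A :: "('g, 'a::banach) atlas"
    and c :: "('g, 'a) chart"
    and E :: "'a \<Rightarrow> 'g"
    and V :: "'a set"
    and W :: "'g set"
    and d :: "'g \<Rightarrow> 'g \<Rightarrow> real"
    and M :: "'w measure"
    and F :: "real \<Rightarrow> real \<Rightarrow> 'w measure"
    and x :: "real \<Rightarrow> real \<Rightarrow> 'w \<Rightarrow> 'g"
  assumes "banach_lie_group G A"
    and "separable_space (euclidean :: 'g topology)"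
    and "lie_exponential G A c E"
    and "log_domains G A E V W"
    and "Metric_space UNIV d"
    and "Metric_space.mtopology UNIV d = euclidean"
    and "\<forall>g h k. d (g \<otimes> h) (g \<otimes> k) = d h k"
    and "prob_space M"
    and "complete_measure M"
    and "additive_filtration M F"
    and "usual_hypotheses M F"
    and "multiplicative_process G M F x"
    and "\<forall>\<omega>\<in>space M. cadlag2 (\<lambda>s t. x s t \<omega>)"
    and "bounded_jumps G E W M x"
  shows "(\<forall>r u \<alpha>. 0 < r \<longrightarrow> r < u \<longrightarrow>
            (\<lambda>\<omega>. sup_exp_dist d \<alpha> (\<lambda>t. x 0 t \<omega>) r u) \<in> borel_measurable M \<and>
            (\<integral>\<^sup>+ \<omega>. sup_exp_dist d \<alpha> (\<lambda>t. x 0 t \<omega>) r u \<partial>M) < \<infinity>) \<and>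
         (\<forall>\<alpha>. \<forall>T>0. \<forall>\<epsilon>>0. \<exists>H>0. \<forall>r u. 0 < r \<longrightarrow> r < u \<longrightarrow> u < T \<longrightarrow> u - r < H \<longrightarrow>
            (\<integral>\<^sup>+ \<omega>. (sup_exp_dist d \<alpha> (\<lambda>t. x 0 t \<omega>) r u - 1) \<partial>M) < ennreal \<epsilon>)"
proof -
  interpret lie: banach_lie_group G A by fact
  interpret left_invariant_metric G d
    using assms(5-7) lie.carrier_UNIV
    by (intro left_invariant_metric.intro lie.group_axioms left_invariant_metric_axioms.intro) auto
  obtain C where "0 \<le> C" "AE \<omega> in M. \<forall>t\<ge>0. len (jump_at G (\<lambda>s t. x s t \<omega>) t) \<le> C"
    using bounded_jumps_len[OF assms(3,4,14)] .
  \<comment> \<open>From here on only distances along the path \<open>x 0\<close> matter.\<close>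
  then interpret X: metric_indep_increments M d F "x 0" C
    by (rule metric_indep_increments_multiplicative_process[OF assms(8-13)])
  show ?thesis
  proof (intro conjI allI impI)
    fix r u \<alpha> :: real
    assume "0 < r" "r < u"
    then have ru: "0 \<le> r" "r \<le> u" by simp_all
    show "(\<lambda>\<omega>. sup_exp_dist d \<alpha> (\<lambda>t. x 0 t \<omega>) r u) \<in> borel_measurable M"
      using ru by (rule X.sup_exp_measurable)
    show "(\<integral>\<^sup>+ \<omega>. sup_exp_dist d \<alpha> (\<lambda>t. x 0 t \<omega>) r u \<partial>M) < \<infinity>"
      using ru by (rule X.nn_integral_sup_exp_finite)
  next
    fix \<alpha> T \<epsilon> :: real
    assume "0 < \<epsilon>"
    from X.nn_integral_sup_exp_minus_1[OF this, of T \<alpha>]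
    show "\<exists>H>0. \<forall>r u. 0 < r \<longrightarrow> r < u \<longrightarrow> u < T \<longrightarrow> u - r < H \<longrightarrow>
            (\<integral>\<^sup>+ \<omega>. (sup_exp_dist d \<alpha> (\<lambda>t. x 0 t \<omega>) r u - 1) \<partial>M) < ennreal \<epsilon>"
      by (meson less_imp_le)
  qed
qed

end
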